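(* Let $(A,\mathcal H)$ be a commutative Hopf algebroid over $\Bbbk$. Then the Kähler module $\Omega_A^s(\mathcal H)$ of $\mathcal H$ with respect to the source map is, up to a canonical isomorphism, given by $$\Omega_A^s(\mathcal H)\cong{}_s\mathcal H_t\otimes_A{}_s\Big(\frac{\mathcal I}{\mathcal I^2}\Big),$$ with universal derivation $$\psi^s:\mathcal H\longrightarrow{}_s\mathcal H_t\otimes_A{}_s\Big(\frac{\mathcal I}{\mathcal I^2}\Big),\qquad u\longmapsto u_1\otimes_A\pi^s(u_2).$$
   Context: $\Bbbk$ is a field. A commutative Hopf algebroid $(A,\mathcal H)$ over $\Bbbk$ consists of commutative $\Bbbk$-algebras with algebra maps $s,t:A\to\mathcal H$, $\Delta:\mathcal H\to\mathcal H\otimes_A\mathcal H$ ($u\mapsto u_1\otimes_Au_2$), $\varepsilon:\mathcal H\to A$, $\mathcal S:\mathcal H\to\mathcal H$, where $\mathcal H$ is the $A$-bimodule ${}_s\mathcal H_t$ (left via $s$, right via $t$), $\Delta,\varepsilon$ are $A$-bilinear, coassociative and counital, $\mathcal Ss=t$, $\mathcal St=s$, $\mathcal S^2=\mathrm{id}$, $\mathcal S(h_1)h_2=t(\varepsilon(h))$, $h_1\mathcal S(h_2)=s(\varepsilon(h))$. $\mathcal I=\ker\varepsilon$, ${}_s(\mathcal I/\mathcal I^2)$ is $\mathcal I/\mathcal I^2$ as an $A$-module via $s$, and $\pi^s:\mathcal H\to\mathcal I/\mathcal I^2$, $u\mapsto(u-s(\varepsilon(u)))+\mathcal I^2$. The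 tensor product ${}_s\mathcal H_t\otimes_A{}_s(\mathcal I/\mathcal I^2)$ uses the right $A$-action on $\mathcal H$ via $t$, and is an $\mathcal H$-module via multiplication on the left factor. The Kähler module $\Omega_A^s(\mathcal H)$ is the module of Kähler differentials of $\mathcal H$ regarded as an $A$-algebra via $s$, i.e. the $\mathcal H$-module representing $M\mapsto\mathrm{Der}_\Bbbk^{\,s}(\mathcal H,M)=\{\delta:\mathcal H\to M\ \Bbbk\text{-linear}\mid\delta(uv)=u\delta(v)+v\delta(u),\ \delta\circ s=0\}$ on $\mathcal H$-modules. *)

theory Defs
  imports
    "HOL-Algebra.Module"
    "HOL-Algebra.Free_Abelian_Groups"
    "HOL-Algebra.Ideal_Product"
    "HOL-Algebra.QuotRing"
begin

section \<open>Abelian groups by generators and relations\<close>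

text \<open>
  Tensor products and the Kaehler module are both built as quotients of a free abelian group on a
  set \<open>G\<close> by the subgroup generated by a set \<open>R\<close> of relations.  These quotients are viewed
  as modules over some ring, with no multiplication of their own: the fields \<open>mult\<close> and \<open>one\<close>
  of the record are irrelevant for modules and are left unspecified.
\<close>

definition presented_group :: "'x set \<Rightarrow> ('x \<Rightarrow>\<^sub>0 int) set \<Rightarrow> ('x \<Rightarrow>\<^sub>0 int) set ring" where
  "presented_group G R =
    (let Q = free_Abelian_group G Mod generate (free_Abelian_group G) R
     in \<lparr>carrier = carrier Q, monoid.mult = undefined, monoid.one = undefined,
         ring.zero = \<one>\<^bsub>Q\<^esub>, ring.add = monoid.mult Q\<rparr>)"

definition presented_class :: "'x set \<Rightarrow> ('x \<Rightarrow>\<^sub>0 int) set \<Rightarrow> 'x \<Rightarrow> ('x \<Rightarrow>\<^sub>0 int) set" where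
  "presented_class G R x =
    generate (free_Abelian_group G) R #>\<^bsub>free_Abelian_group G\<^esub> frag_of x"

definition free_eval :: "('p, 'r) ring_scheme \<Rightarrow> ('x \<Rightarrow> 'p) \<Rightarrow> ('x \<Rightarrow>\<^sub>0 int) \<Rightarrow> 'p" where
  "free_eval P f c =
    (\<Oplus>\<^bsub>P\<^esub>x\<in>Poly_Mapping.keys c. [Poly_Mapping.lookup c x] \<cdot>\<^bsub>P\<^esub> f x)"

text \<open>
  The additive map out of a presented group that is prescribed by \<open>f\<close> on generators.  It is
  meaningful when \<open>f\<close> takes values in the abelian group \<open>P\<close> and respects the relations, so that
  \<open>free_eval P f\<close> is constant on the coset \<open>C\<close>.
\<close>
definition presented_lift :: "('p, 'r) ring_scheme \<Rightarrow> ('x \<Rightarrow> 'p) \<Rightarrow> ('x \<Rightarrow>\<^sub>0 int) set \<Rightarrow> 'p" where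
  "presented_lift P f C = the_elem (free_eval P f ` C)"

definition presented_module ::
  "'x set \<Rightarrow> ('x \<Rightarrow>\<^sub>0 int) set \<Rightarrow> ('r \<Rightarrow> 'x \<Rightarrow> 'x) \<Rightarrow> ('r, ('x \<Rightarrow>\<^sub>0 int) set) module" where
  "presented_module G R act = ring.extend (presented_group G R)
    \<lparr>smult = (\<lambda>r. presented_lift (presented_group G R) (\<lambda>x. presented_class G R (act r x)))\<rparr>"


section \<open>Modules\<close>

definition regular_module :: "('r, 'z) ring_scheme \<Rightarrow> ('r, 'r) module" where
  "regular_module R =
    \<lparr>carrier = carrier R, monoid.mult = monoid.mult R, monoid.one = \<one>\<^bsub>R\<^esub>,
     ring.zero = \<zero>\<^bsub>R\<^esub>, ring.add = ring.add R, smult = monoid.mult R\<rparr>"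

definition restrict_scalars :: "('a \<Rightarrow> 'r) \<Rightarrow> ('r, 'm) module \<Rightarrow> ('a, 'm) module" where
  "restrict_scalars f M =
    \<lparr>carrier = carrier M, monoid.mult = monoid.mult M, monoid.one = \<one>\<^bsub>M\<^esub>,
     ring.zero = \<zero>\<^bsub>M\<^esub>, ring.add = ring.add M,
     smult = (\<lambda>a m. f a \<odot>\<^bsub>M\<^esub> m)\<rparr>"

text \<open>Maps are taken extensional, so that equality of maps is equality on the carrier.\<close>

definition module_hom ::
  "('r, 'z) ring_scheme \<Rightarrow> ('r, 'm) module \<Rightarrow> ('r, 'n) module \<Rightarrow> ('m \<Rightarrow> 'n) set" where
  "module_hom R M N = {f \<in> carrier M \<rightarrow>\<^sub>E carrier N.
    (\<forall>x\<in>carrier M. \<forall>y\<in>carrier M. f (x \<oplus>\<^bsub>M\<^esub> y) = f x \<oplus>\<^bsub>N\<^esub> f y) \<and>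
    (\<forall>r\<in>carrier R. \<forall>x\<in>carrier M. f (r \<odot>\<^bsub>M\<^esub> x) = r \<odot>\<^bsub>N\<^esub> f x)}"

definition module_iso ::
  "('r, 'z) ring_scheme \<Rightarrow> ('r, 'm) module \<Rightarrow> ('r, 'n) module \<Rightarrow> ('m \<Rightarrow> 'n) set" where
  "module_iso R M N = {f \<in> module_hom R M N. bij_betw f (carrier M) (carrier N)}"

definition algebra_hom ::
  "('k, 'z) ring_scheme \<Rightarrow> ('k, 'b) module \<Rightarrow> ('k, 'c) module \<Rightarrow> ('b \<Rightarrow> 'c) set" where
  "algebra_hom K B C = {f \<in> ring_hom B C.
    \<forall>c\<in>carrier K. \<forall>x\<in>carrier B. f (c \<odot>\<^bsub>B\<^esub> x) = c \<odot>\<^bsub>C\<^esub> f x}"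


section \<open>Tensor products over a commutative ring\<close>

definition tensor_rels ::
  "('a, 'z) ring_scheme \<Rightarrow> ('a, 'm) module \<Rightarrow> ('a, 'n) module \<Rightarrow> ('m \<times> 'n \<Rightarrow>\<^sub>0 int) set" where
  "tensor_rels A M N =
    {frag_of (x \<oplus>\<^bsub>M\<^esub> x', y) - frag_of (x, y) - frag_of (x', y) | x x' y.
       x \<in> carrier M \<and> x' \<in> carrier M \<and> y \<in> carrier N} \<union>
    {frag_of (x, y \<oplus>\<^bsub>N\<^esub> y') - frag_of (x, y) - frag_of (x, y') | x y y'.
       x \<in> carrier M \<and> y \<in> carrier N \<and> y' \<in> carrier N} \<union>
    {frag_of (a \<odot>\<^bsub>M\<^esub> x, y) - frag_of (x, a \<odot>\<^bsub>N\<^esub> y) | a x y.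
       a \<in> carrier A \<and> x \<in> carrier M \<and> y \<in> carrier N}"

definition pure_tensor ::
  "('a, 'z) ring_scheme \<Rightarrow> ('a, 'm) module \<Rightarrow> ('a, 'n) module \<Rightarrow> 'm \<Rightarrow> 'n \<Rightarrow> ('m \<times> 'n \<Rightarrow>\<^sub>0 int) set"
  where "pure_tensor A M N x y =
    presented_class (carrier M \<times> carrier N) (tensor_rels A M N) (x, y)"

text \<open>
  The additive map \<open>x \<otimes> y \<mapsto> f x y\<close>, for \<open>f\<close> biadditive and balanced over \<open>A\<close>.
\<close>
definition tensor_lift ::
  "('p, 'r) ring_scheme \<Rightarrow> ('m \<Rightarrow> 'n \<Rightarrow> 'p) \<Rightarrow> ('m \<times> 'n \<Rightarrow>\<^sub>0 int) set \<Rightarrow> 'p" where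
  "tensor_lift P f = presented_lift P (\<lambda>(x, y). f x y)"

text \<open>
  The abelian group \<open>M \<otimes>\<^sub>A N\<close>, made into a module over a further ring of scalars through an
  action \<open>act\<close> of these scalars on the left factor (commuting with the action of \<open>A\<close>).
\<close>
definition tensor_module ::
  "('a, 'z) ring_scheme \<Rightarrow> ('r \<Rightarrow> 'm \<Rightarrow> 'm) \<Rightarrow> ('a, 'm) module \<Rightarrow> ('a, 'n) module \<Rightarrow>
     ('r, ('m \<times> 'n \<Rightarrow>\<^sub>0 int) set) module" where
  "tensor_module A act M N =
    presented_module (carrier M \<times> carrier N) (tensor_rels A M N) (\<lambda>r (x, y). (act r x, y))"

text \<open>If \<open>M\<close> and \<open>N\<close> are \<open>A\<close>-algebras: \<open>(x \<otimes> y)(x' \<otimes> y') = xx' \<otimes> yy'\<close>.\<close>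
definition tensor_algebra ::
  "('a, 'z) ring_scheme \<Rightarrow> ('r \<Rightarrow> 'm \<Rightarrow> 'm) \<Rightarrow> ('a, 'm) module \<Rightarrow> ('a, 'n) module \<Rightarrow>
     ('r, ('m \<times> 'n \<Rightarrow>\<^sub>0 int) set) module" where
  "tensor_algebra A act M N = (tensor_module A act M N)
    \<lparr>monoid.mult := (\<lambda>U V.
        tensor_lift (tensor_module A act M N)
          (\<lambda>x y. tensor_lift (tensor_module A act M N)
             (\<lambda>x' y'. pure_tensor A M N (x \<otimes>\<^bsub>M\<^esub> x') (y \<otimes>\<^bsub>N\<^esub> y')) V) U),
     monoid.one := pure_tensor A M N \<one>\<^bsub>M\<^esub> \<one>\<^bsub>N\<^esub>\<rparr>"


section \<open>Commutative Hopf algebroids\<close>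

text \<open>The commutative ring \<open>H\<close> as an \<open>A\<close>-algebra along the ring homomorphism \<open>f : A \<rightarrow> H\<close>.\<close>
definition along :: "('a \<Rightarrow> 'h) \<Rightarrow> ('h, 'z) ring_scheme \<Rightarrow> ('a, 'h) module" where
  "along f H = restrict_scalars f (regular_module H)"

text \<open>
  In \<open>H \<otimes>\<^sub>A H\<close> the left factor is a right \<open>A\<close>-module via the target \<open>t\<close> and the right
  factor is a left \<open>A\<close>-module via the source \<open>s\<close>.
\<close>
locale hopf_algebroid_data =
  fixes K :: "'k ring" and A :: "('k, 'a) module" and H :: "('k, 'h) module"
    and s t :: "'a \<Rightarrow> 'h"
begin

definition HH :: "('k, ('h \<times> 'h \<Rightarrow>\<^sub>0 int) set) module" where
  "HH = tensor_algebra A (smult H) (along t H) (along s H)"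

definition HH_pure :: "'h \<Rightarrow> 'h \<Rightarrow> ('h \<times> 'h \<Rightarrow>\<^sub>0 int) set" where
  "HH_pure = pure_tensor A (along t H) (along s H)"

text \<open>
  The left and the right \<open>A\<close>-action of the bimodule \<open>H \<otimes>\<^sub>A H\<close>, namely
  \<open>a \<cdot> (u \<otimes> v) = s(a)u \<otimes> v\<close> and \<open>(u \<otimes> v) \<cdot> a = u \<otimes> v t(a)\<close>.
\<close>
definition HH_left :: "('a, ('h \<times> 'h \<Rightarrow>\<^sub>0 int) set) module" where
  "HH_left = along (\<lambda>a. HH_pure (s a) \<one>\<^bsub>H\<^esub>) HH"

definition HH_right :: "('a, ('h \<times> 'h \<Rightarrow>\<^sub>0 int) set) module" where
  "HH_right = along (\<lambda>a. HH_pure \<one>\<^bsub>H\<^esub> (t a)) HH"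

text \<open>\<open>(H \<otimes>\<^sub>A H) \<otimes>\<^sub>A H\<close>, \<open>H \<otimes>\<^sub>A (H \<otimes>\<^sub>A H)\<close> and the associativity
  map \<open>(u \<otimes> v) \<otimes> w \<mapsto> u \<otimes> (v \<otimes> w)\<close> between them.\<close>

definition HH_H :: "('k, (('h \<times> 'h \<Rightarrow>\<^sub>0 int) set \<times> 'h \<Rightarrow>\<^sub>0 int) set) module" where
  "HH_H = tensor_algebra A (smult HH) HH_right (along s H)"

definition HH_H_pure ::
  "('h \<times> 'h \<Rightarrow>\<^sub>0 int) set \<Rightarrow> 'h \<Rightarrow> (('h \<times> 'h \<Rightarrow>\<^sub>0 int) set \<times> 'h \<Rightarrow>\<^sub>0 int) set" where
  "HH_H_pure = pure_tensor A HH_right (along s H)"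

definition H_HH :: "('k, ('h \<times> ('h \<times> 'h \<Rightarrow>\<^sub>0 int) set \<Rightarrow>\<^sub>0 int) set) module" where
  "H_HH = tensor_algebra A (smult H) (along t H) HH_left"

definition H_HH_pure ::
  "'h \<Rightarrow> ('h \<times> 'h \<Rightarrow>\<^sub>0 int) set \<Rightarrow> ('h \<times> ('h \<times> 'h \<Rightarrow>\<^sub>0 int) set \<Rightarrow>\<^sub>0 int) set" where
  "H_HH_pure = pure_tensor A (along t H) HH_left"

definition assoc_map ::
  "(('h \<times> 'h \<Rightarrow>\<^sub>0 int) set \<times> 'h \<Rightarrow>\<^sub>0 int) set \<Rightarrow> ('h \<times> ('h \<times> 'h \<Rightarrow>\<^sub>0 int) set \<Rightarrow>\<^sub>0 int) set" where
  "assoc_map =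
    tensor_lift H_HH (\<lambda>U w. tensor_lift H_HH (\<lambda>u v. H_HH_pure u (HH_pure v w)) U)"

end

text \<open>
  In the counit axioms, \<open>A \<otimes>\<^sub>A H\<close> and \<open>H \<otimes>\<^sub>A A\<close> are identified with \<open>H\<close> by
  \<open>a \<otimes> u \<mapsto> s(a)u\<close> and \<open>u \<otimes> a \<mapsto> u t(a)\<close>.
\<close>
locale commutative_hopf_algebroid = hopf_algebroid_data K A H s t
  for K :: "'k ring" and A :: "('k, 'a) module" and H :: "('k, 'h) module"
    and s t :: "'a \<Rightarrow> 'h" +
  fixes \<Delta> :: "'h \<Rightarrow> ('h \<times> 'h \<Rightarrow>\<^sub>0 int) set"
    and \<epsilon> :: "'h \<Rightarrow> 'a"
    and S :: "'h \<Rightarrow> 'h"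
  assumes field_K: "field K"
    and algebra_A: "algebra K A"
    and algebra_H: "algebra K H"
    and s_hom: "s \<in> algebra_hom K A H"
    and t_hom: "t \<in> algebra_hom K A H"
    and \<Delta>_hom: "\<Delta> \<in> algebra_hom K H HH"
    and \<epsilon>_hom: "\<epsilon> \<in> algebra_hom K H A"
    and S_hom: "S \<in> algebra_hom K H H"
    and \<Delta>_left: "\<lbrakk>a \<in> carrier A; u \<in> carrier H\<rbrakk> \<Longrightarrow> \<Delta> (s a \<otimes>\<^bsub>H\<^esub> u) = a \<odot>\<^bsub>HH_left\<^esub> \<Delta> u"
    and \<Delta>_right: "\<lbrakk>a \<in> carrier A; u \<in> carrier H\<rbrakk> \<Longrightarrow> \<Delta> (u \<otimes>\<^bsub>H\<^esub> t a) = a \<odot>\<^bsub>HH_right\<^esub> \<Delta> u"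
    and \<epsilon>_left: "\<lbrakk>a \<in> carrier A; u \<in> carrier H\<rbrakk> \<Longrightarrow> \<epsilon> (s a \<otimes>\<^bsub>H\<^esub> u) = a \<otimes>\<^bsub>A\<^esub> \<epsilon> u"
    and \<epsilon>_right: "\<lbrakk>a \<in> carrier A; u \<in> carrier H\<rbrakk> \<Longrightarrow> \<epsilon> (u \<otimes>\<^bsub>H\<^esub> t a) = \<epsilon> u \<otimes>\<^bsub>A\<^esub> a"
    and coassociative: "u \<in> carrier H \<Longrightarrow>
      assoc_map (tensor_lift HH_H (\<lambda>u1 u2. HH_H_pure (\<Delta> u1) u2) (\<Delta> u)) =
      tensor_lift H_HH (\<lambda>u1 u2. H_HH_pure u1 (\<Delta> u2)) (\<Delta> u)"
    and counit_left: "u \<in> carrier H \<Longrightarrow> tensor_lift H (\<lambda>u1 u2. s (\<epsilon> u1) \<otimes>\<^bsub>H\<^esub> u2) (\<Delta> u) = u"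
    and counit_right: "u \<in> carrier H \<Longrightarrow> tensor_lift H (\<lambda>u1 u2. u1 \<otimes>\<^bsub>H\<^esub> t (\<epsilon> u2)) (\<Delta> u) = u"
    and S_s: "a \<in> carrier A \<Longrightarrow> S (s a) = t a"
    and S_t: "a \<in> carrier A \<Longrightarrow> S (t a) = s a"
    and S_S: "u \<in> carrier H \<Longrightarrow> S (S u) = u"
    and antipode_left:
      "u \<in> carrier H \<Longrightarrow> tensor_lift H (\<lambda>u1 u2. S u1 \<otimes>\<^bsub>H\<^esub> u2) (\<Delta> u) = t (\<epsilon> u)"
    and antipode_right:
      "u \<in> carrier H \<Longrightarrow> tensor_lift H (\<lambda>u1 u2. u1 \<otimes>\<^bsub>H\<^esub> S u2) (\<Delta> u) = s (\<epsilon> u)"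


section \<open>The module \<open>I/I\<^sup>2\<close> and Kaehler differentials\<close>

text \<open>
  \<open>I/I\<^sup>2\<close> as an \<open>H\<close>-module, realised inside the quotient ring \<open>H/I\<^sup>2\<close>.  Its fields
  \<open>mult\<close> and \<open>one\<close> play no role.
\<close>
definition cotangent_module :: "('h, 'z) ring_scheme \<Rightarrow> 'h set \<Rightarrow> ('h, 'h set) module" where
  "cotangent_module H I =
    (let J = I \<cdot>\<^bsub>H\<^esub> I; Q = H Quot J in
     \<lparr>carrier = (\<lambda>x. J +>\<^bsub>H\<^esub> x) ` I, monoid.mult = monoid.mult Q, monoid.one = \<one>\<^bsub>Q\<^esub>,
      ring.zero = \<zero>\<^bsub>Q\<^esub>, ring.add = ring.add Q,
      smult = (\<lambda>h U. (J +>\<^bsub>H\<^esub> h) \<otimes>\<^bsub>Q\<^esub> U)\<rparr>)"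

definition aug_ideal :: "('k, 'a) module \<Rightarrow> ('k, 'h) module \<Rightarrow> ('h \<Rightarrow> 'a) \<Rightarrow> 'h set" where
  "aug_ideal A H \<epsilon> = a_kernel H A \<epsilon>"

definition cotangent_s ::
  "('k, 'a) module \<Rightarrow> ('k, 'h) module \<Rightarrow> ('a \<Rightarrow> 'h) \<Rightarrow> ('h \<Rightarrow> 'a) \<Rightarrow> ('a, 'h set) module" where
  "cotangent_s A H s \<epsilon> = restrict_scalars s (cotangent_module H (aug_ideal A H \<epsilon>))"

definition \<pi>\<^sub>s :: "('k, 'a) module \<Rightarrow> ('k, 'h) module \<Rightarrow> ('a \<Rightarrow> 'h) \<Rightarrow> ('h \<Rightarrow> 'a) \<Rightarrow> 'h \<Rightarrow> 'h set" where
  "\<pi>\<^sub>s A H s \<epsilon> u =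
    (aug_ideal A H \<epsilon> \<cdot>\<^bsub>H\<^esub> aug_ideal A H \<epsilon>) +>\<^bsub>H\<^esub> (u \<ominus>\<^bsub>H\<^esub> s (\<epsilon> u))"

text \<open>\<open>H\<^sub>t \<otimes>\<^sub>A \<^sub>s(I/I\<^sup>2)\<close> as an \<open>H\<close>-module by multiplication on the left factor.\<close>
definition H_tensor_cotangent ::
  "('k, 'a) module \<Rightarrow> ('k, 'h) module \<Rightarrow> ('a \<Rightarrow> 'h) \<Rightarrow> ('a \<Rightarrow> 'h) \<Rightarrow> ('h \<Rightarrow> 'a) \<Rightarrow>
     ('h, ('h \<times> 'h set \<Rightarrow>\<^sub>0 int) set) module" where
  "H_tensor_cotangent A H s t \<epsilon> = tensor_module A (monoid.mult H) (along t H) (cotangent_s A H s \<epsilon>)"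

definition \<psi>\<^sub>s ::
  "('k, 'a) module \<Rightarrow> ('k, 'h) module \<Rightarrow> ('a \<Rightarrow> 'h) \<Rightarrow> ('a \<Rightarrow> 'h) \<Rightarrow>
     ('h \<Rightarrow> ('h \<times> 'h \<Rightarrow>\<^sub>0 int) set) \<Rightarrow> ('h \<Rightarrow> 'a) \<Rightarrow> 'h \<Rightarrow> ('h \<times> 'h set \<Rightarrow>\<^sub>0 int) set" where
  "\<psi>\<^sub>s A H s t \<Delta> \<epsilon> = (\<lambda>u\<in>carrier H.
    tensor_lift (H_tensor_cotangent A H s t \<epsilon>)
      (\<lambda>u1 u2. pure_tensor A (along t H) (cotangent_s A H s \<epsilon>) u1 (\<pi>\<^sub>s A H s \<epsilon> u2)) (\<Delta> u))"

text \<open>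
  \<open>Der\<^sub>K\<^sup>s(H, M)\<close>.  An \<open>H\<close>-module \<open>M\<close> is a \<open>K\<close>-vector space through the structure
  map \<open>c \<mapsto> c 1\<^sub>H\<close> of the \<open>K\<close>-algebra \<open>H\<close>.
\<close>
definition Der_s ::
  "'k ring \<Rightarrow> ('k, 'a) module \<Rightarrow> ('k, 'h) module \<Rightarrow> ('a \<Rightarrow> 'h) \<Rightarrow> ('h, 'm) module \<Rightarrow> ('h \<Rightarrow> 'm) set"
  where "Der_s K A H s M = {\<delta> \<in> carrier H \<rightarrow>\<^sub>E carrier M.
    (\<forall>u\<in>carrier H. \<forall>v\<in>carrier H. \<delta> (u \<oplus>\<^bsub>H\<^esub> v) = \<delta> u \<oplus>\<^bsub>M\<^esub> \<delta> v) \<and>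
    (\<forall>c\<in>carrier K. \<forall>u\<in>carrier H. \<delta> (c \<odot>\<^bsub>H\<^esub> u) = (c \<odot>\<^bsub>H\<^esub> \<one>\<^bsub>H\<^esub>) \<odot>\<^bsub>M\<^esub> \<delta> u) \<and>
    (\<forall>u\<in>carrier H. \<forall>v\<in>carrier H. \<delta> (u \<otimes>\<^bsub>H\<^esub> v) = u \<odot>\<^bsub>M\<^esub> \<delta> v \<oplus>\<^bsub>M\<^esub> v \<odot>\<^bsub>M\<^esub> \<delta> u) \<and>
    (\<forall>a\<in>carrier A. \<delta> (s a) = \<zero>\<^bsub>M\<^esub>)}"

text \<open>
  The Kaehler module \<open>\<Omega>\<^sub>A\<^sup>s(H)\<close> of \<open>H\<close> as an \<open>A\<close>-algebra via \<open>s\<close>, presented as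
  an abelian group by generators \<open>(h, u)\<close>, standing for \<open>h du\<close>, that are additive in \<open>h\<close> and
  in \<open>u\<close> and satisfy \<open>h d(uv) = hu dv + hv du\<close> and \<open>h d(s a) = 0\<close>.  The scalars act on \<open>h\<close>;
  linearity of \<open>d\<close> over \<open>A\<close>, hence over \<open>K\<close>, is a consequence of the relations.
\<close>
definition kaehler_rels ::
  "('k, 'a) module \<Rightarrow> ('k, 'h) module \<Rightarrow> ('a \<Rightarrow> 'h) \<Rightarrow> ('h \<times> 'h \<Rightarrow>\<^sub>0 int) set" where
  "kaehler_rels A H s =
    {frag_of (h \<oplus>\<^bsub>H\<^esub> h', u) - frag_of (h, u) - frag_of (h', u) | h h' u.
       h \<in> carrier H \<and> h' \<in> carrier H \<and> u \<in> carrier H} \<union>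
    {frag_of (h, u \<oplus>\<^bsub>H\<^esub> v) - frag_of (h, u) - frag_of (h, v) | h u v.
       h \<in> carrier H \<and> u \<in> carrier H \<and> v \<in> carrier H} \<union>
    {frag_of (h, u \<otimes>\<^bsub>H\<^esub> v) - frag_of (h \<otimes>\<^bsub>H\<^esub> u, v) - frag_of (h \<otimes>\<^bsub>H\<^esub> v, u) | h u v.
       h \<in> carrier H \<and> u \<in> carrier H \<and> v \<in> carrier H} \<union>
    {frag_of (h, s a) | h a. h \<in> carrier H \<and> a \<in> carrier A}"

definition kaehler_module ::
  "('k, 'a) module \<Rightarrow> ('k, 'h) module \<Rightarrow> ('a \<Rightarrow> 'h) \<Rightarrow> ('h, ('h \<times> 'h \<Rightarrow>\<^sub>0 int) set) module" where
  "kaehler_module A H s =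
    presented_module (carrier H \<times> carrier H) (kaehler_rels A H s) (\<lambda>r (h, u). (r \<otimes>\<^bsub>H\<^esub> h, u))"

definition kaehler_d ::
  "('k, 'a) module \<Rightarrow> ('k, 'h) module \<Rightarrow> ('a \<Rightarrow> 'h) \<Rightarrow> 'h \<Rightarrow> ('h \<times> 'h \<Rightarrow>\<^sub>0 int) set" where
  "kaehler_d A H s = (\<lambda>u\<in>carrier H.
    presented_class (carrier H \<times> carrier H) (kaehler_rels A H s) (\<one>\<^bsub>H\<^esub>, u))"

text \<open>
  For a fixed \<open>M\<close>: composition with \<open>d\<close> is a bijection \<open>Hom\<^sub>H(\<Omega>, M) \<longrightarrow> Der\<^sub>K\<^sup>s(H, M)\<close>.
\<close>
definition represents_Der_s ::
  "'k ring \<Rightarrow> ('k, 'a) module \<Rightarrow> ('k, 'h) module \<Rightarrow> ('a \<Rightarrow> 'h) \<Rightarrow>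
     ('h, 'w) module \<Rightarrow> ('h \<Rightarrow> 'w) \<Rightarrow> ('h, 'm) module \<Rightarrow> bool" where
  "represents_Der_s K A H s \<Omega> d M \<longleftrightarrow>
    bij_betw (\<lambda>f. compose (carrier H) f d) (module_hom H \<Omega> M) (Der_s K A H s M)"

end

theory Submission
  imports Defs
begin

text \<open>
  Differentials on a group are trivialised by left translation, and the same happens here.  Write
  \<open>\<Omega>\<close> for \<open>H\<^sub>t \<otimes>\<^sub>A \<^sub>s(I/I\<^sup>2)\<close>.  Since \<open>\<pi>\<close> is a derivation at the counit
  (\<open>\<pi>_mult\<close>), the counit axiom makes \<open>\<psi> u = u\<^sub>1 \<otimes> \<pi>(u\<^sub>2)\<close> a derivation (\<open>\<psi>_Der\<close>).

  A derivation \<open>\<delta> : H \<rightarrow> M\<close> with \<open>\<delta> \<circ> s = 0\<close> is twisted by the antipode into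
  \<open>g(u) = S(u\<^sub>1) \<delta>(u\<^sub>2)\<close> (\<open>invariant_form\<close>).  By the antipode axiom, \<open>g\<close> is a derivation
  with coefficients \<open>t \<circ> \<epsilon>\<close>; so it vanishes on \<open>I\<^sup>2\<close>.  Like \<open>\<delta>\<close>, it vanishes on
  \<open>s(A)\<close>.  Therefore it factors through \<open>\<pi>\<close> and yields an \<open>H\<close>-linear map \<open>u \<otimes> \<pi>(v) \<mapsto> u g(v)\<close> on \<open>\<Omega>\<close>.  Its composite with
  \<open>\<psi>\<close> is \<open>u\<^sub>1 S(u\<^sub>2) \<delta>(u\<^sub>3) = \<delta>(u)\<close> (\<open>induced_map_\<psi>\<close>).  Conversely, a map out of
  \<open>\<Omega>\<close> is determined by its composite with \<open>\<psi>\<close>, because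
  \<open>1 \<otimes> \<pi>(v) = S(v\<^sub>1) \<psi>(v\<^sub>2)\<close> (\<open>pure_eq_antipode_\<psi>\<close>).  Thus \<open>\<psi>\<close> is universal
  (\<open>\<psi>_universal\<close>).  The Kaehler module is universal by its presentation
  (\<open>kaehler_universal\<close>), and two universal derivations are related by exactly one isomorphism
  (\<open>representing_unique_iso\<close>).

  Expressions such as \<open>u\<^sub>1 S(u\<^sub>2) \<delta>(u\<^sub>3)\<close> are additive maps evaluated at \<open>\<Delta> u\<close>.  They
  are never expanded into finite sums: two additive maps on a tensor product are equal if they agree
  on pure tensors, and \<open>coassociative_trilinear\<close> says that the two ways to split \<open>u\<close> into
  three factors give the same value for every suitable map of three variables.
\<close>

section \<open>Additive maps and abelian groups by generators and relations\<close>

text \<open>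
  Additive maps see only the carrier and the addition of a ring record.  Hence they can be moved
  between a tensor product taken as a group, as a module and as an algebra.
\<close>

definition add_hom :: "('a, 'b) ring_scheme \<Rightarrow> ('c, 'd) ring_scheme \<Rightarrow> ('a \<Rightarrow> 'c) set" where
  "add_hom T P = {h \<in> carrier T \<rightarrow> carrier P.
     \<forall>x\<in>carrier T. \<forall>y\<in>carrier T. h (x \<oplus>\<^bsub>T\<^esub> y) = h x \<oplus>\<^bsub>P\<^esub> h y}"

lemma add_homI:
  assumes "\<And>x. x \<in> carrier T \<Longrightarrow> h x \<in> carrier P"
    and "\<And>x y. x \<in> carrier T \<Longrightarrow> y \<in> carrier T \<Longrightarrow> h (x \<oplus>\<^bsub>T\<^esub> y) = h x \<oplus>\<^bsub>P\<^esub> h y"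
  shows "h \<in> add_hom T P"
  using assms by (auto simp: add_hom_def)

lemma add_hom_closed: "h \<in> add_hom T P \<Longrightarrow> x \<in> carrier T \<Longrightarrow> h x \<in> carrier P"
  by (auto simp: add_hom_def)

lemma add_hom_add:
  "h \<in> add_hom T P \<Longrightarrow> x \<in> carrier T \<Longrightarrow> y \<in> carrier T \<Longrightarrow> h (x \<oplus>\<^bsub>T\<^esub> y) = h x \<oplus>\<^bsub>P\<^esub> h y"
  by (auto simp: add_hom_def)

lemma add_hom_iff_hom: "h \<in> add_hom T P \<longleftrightarrow> h \<in> hom (add_monoid T) (add_monoid P)"
  by (auto simp: add_hom_def hom_def)

lemma add_hom_comp: "h \<in> add_hom T P \<Longrightarrow> g \<in> add_hom P Q \<Longrightarrow> (\<lambda>x. g (h x)) \<in> add_hom T Q"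
  by (auto simp: add_hom_def Pi_iff)

lemma add_hom_zero:
  assumes "abelian_group T" "abelian_group P" "h \<in> add_hom T P"
  shows "h \<zero>\<^bsub>T\<^esub> = \<zero>\<^bsub>P\<^esub>"
proof -
  interpret T: abelian_group T by fact
  interpret P: abelian_group P by fact
  have "h \<zero>\<^bsub>T\<^esub> \<oplus>\<^bsub>P\<^esub> h \<zero>\<^bsub>T\<^esub> = h \<zero>\<^bsub>T\<^esub>"
    using add_hom_add[OF assms(3), of "\<zero>\<^bsub>T\<^esub>" "\<zero>\<^bsub>T\<^esub>"] by simp
  then show ?thesis using add_hom_closed[OF assms(3) T.zero_closed] by simp
qed

lemma add_hom_pointwise_add:
  assumes "abelian_group P" "f \<in> add_hom T P" "g \<in> add_hom T P"
  shows "(\<lambda>x. f x \<oplus>\<^bsub>P\<^esub> g x) \<in> add_hom T P"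
proof -
  interpret P: abelian_group P by fact
  show ?thesis using assms by (intro add_homI) (auto simp: add_hom_closed add_hom_add P.a_ac)
qed

text \<open>
  Formal sums have varying supports, so additivity of the evaluation is read off from a common
  finite superset of the supports.
\<close>

lemma free_eval_superset:
  assumes "abelian_group P" "f \<in> G \<rightarrow> carrier P" "finite X" "X \<subseteq> G" "Poly_Mapping.keys c \<subseteq> X"
  shows "free_eval P f c = (\<Oplus>\<^bsub>P\<^esub>x\<in>X. add_pow P (Poly_Mapping.lookup c x) (f x))"
proof -
  interpret P: abelian_group P by fact
  have z: "add_pow P (0::int) y = \<zero>\<^bsub>P\<^esub>" for y by (simp add: add_pow_def)
  show ?thesis unfolding free_eval_def
    using assms by (intro P.add.finprod_mono_neutral_cong_left) (auto simp: in_keys_iff Pi_iff z)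
qed

lemma free_eval_hom:
  assumes P: "abelian_group P" and f: "f \<in> G \<rightarrow> carrier P"
  shows "free_eval P f \<in> hom (free_Abelian_group G) (add_monoid P)"
proof (rule homI)
  interpret P: abelian_group P by fact
  fix c d assume "c \<in> carrier (free_Abelian_group G)" "d \<in> carrier (free_Abelian_group G)"
  then have cd: "Poly_Mapping.keys c \<subseteq> G" "Poly_Mapping.keys d \<subseteq> G" by auto
  let ?X = "Poly_Mapping.keys c \<union> Poly_Mapping.keys d"
  have X: "finite ?X" "?X \<subseteq> G" using cd by auto
  have k: "Poly_Mapping.keys (c + d) \<subseteq> ?X" by (rule keys_add)
  have "free_eval P f (c + d) = (\<Oplus>\<^bsub>P\<^esub>x\<in>?X. add_pow P (Poly_Mapping.lookup c x) (f x) \<oplus>\<^bsub>P\<^esub> add_pow P (Poly_Mapping.lookup d x) (f x))"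
    unfolding free_eval_superset[OF P f X k] using f X(2)
    by (intro P.finsum_cong') (auto simp: lookup_add P.add.int_pow_mult Pi_iff subset_iff)
  also have "\<dots> = free_eval P f c \<oplus>\<^bsub>P\<^esub> free_eval P f d"
    using f X(2)
    by (subst P.finsum_addf)
      (auto simp: free_eval_superset[OF P f X] Pi_iff subset_iff)
  finally show "free_eval P f (c \<otimes>\<^bsub>free_Abelian_group G\<^esub> d) = free_eval P f c \<otimes>\<^bsub>add_monoid P\<^esub> free_eval P f d"
    by simp
next
  interpret P: abelian_group P by fact
  fix c assume "c \<in> carrier (free_Abelian_group G)"
  then show "free_eval P f c \<in> carrier (add_monoid P)"
    using f by (auto simp: free_eval_def Pi_iff subset_iff intro!: P.finsum_closed)
qed

lemma free_eval_frag_of: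
  assumes "abelian_group P" "f x \<in> carrier P"
  shows "free_eval P f (frag_of x) = f x"
proof -
  interpret P: abelian_group P by fact
  show ?thesis using assms(2) P.finsum_insert[of "{}" x "\<lambda>y. add_pow P (Poly_Mapping.lookup (frag_of x) y) (f y)"]
    by (simp add: free_eval_def)
qed

lemma comm_group_imp_abelian_group:
  assumes "comm_group Q" "carrier T = carrier Q" "add T = monoid.mult Q" "\<zero>\<^bsub>T\<^esub> = \<one>\<^bsub>Q\<^esub>"
  shows "abelian_group T"
proof -
  interpret Q: comm_group Q by fact
  show ?thesis
    by (rule abelian_groupI) (auto simp: assms(2-) Q.m_ac intro!: bexI[of _ "inv\<^bsub>Q\<^esub> _"])
qed

text \<open>
  Only carrier, addition and zero of \<open>T\<close> are fixed here, so that presented modules and tensor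
  algebras, which differ from the presented group in further record fields, are all instances.
\<close>

locale presents =
  fixes T :: "(('x \<Rightarrow>\<^sub>0 int) set, 'm) ring_scheme" and G :: "'x set" and R :: "('x \<Rightarrow>\<^sub>0 int) set"
  assumes rels: "R \<subseteq> carrier (free_Abelian_group G)"
    and carrier_eq: "carrier T = carrier (free_Abelian_group G Mod generate (free_Abelian_group G) R)"
    and add_eq: "add T = monoid.mult (free_Abelian_group G Mod generate (free_Abelian_group G) R)"
    and zero_eq: "\<zero>\<^bsub>T\<^esub> = \<one>\<^bsub>free_Abelian_group G Mod generate (free_Abelian_group G) R\<^esub>"
begin

abbreviation "F \<equiv> free_Abelian_group G"
abbreviation "N \<equiv> generate F R"
abbreviation "cls \<equiv> presented_class G R"

lemma F_comm: "comm_group F" by (rule abelian_free_Abelian_group)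

lemma N_normal: "N \<lhd> F"
  using rels group.generate_is_subgroup[OF group_free_Abelian_group]
  by (intro comm_group.subgroup_imp_normal[OF F_comm])

lemma T_abelian: "abelian_group T"
proof -
  have "comm_group (F Mod N)"
    using F_comm N_normal by (simp add: comm_group.abelian_FactGroup normal_imp_subgroup)
  then show ?thesis by (rule comm_group_imp_abelian_group) (simp_all only: carrier_eq add_eq zero_eq)
qed

sublocale T: abelian_group T by (rule T_abelian)

lemma coset_closed: "c \<in> carrier F \<Longrightarrow> N #>\<^bsub>F\<^esub> c \<in> carrier T"
  unfolding carrier_eq by (auto simp: FactGroup_def RCOSETS_def)

lemma coset_add:
  assumes "c \<in> carrier F" "d \<in> carrier F"
  shows "(N #>\<^bsub>F\<^esub> c) \<oplus>\<^bsub>T\<^esub> (N #>\<^bsub>F\<^esub> d) = N #>\<^bsub>F\<^esub> (c + d)"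
  using normal.rcos_sum[OF N_normal assms] by (simp add: FactGroup_def add_eq)

lemma coset_hom: "(\<lambda>c. N #>\<^bsub>F\<^esub> c) \<in> hom F (add_monoid T)"
  by (rule homI) (use coset_closed coset_add in auto)

lemma cls_closed: "x \<in> G \<Longrightarrow> cls x \<in> carrier T"
  unfolding presented_class_def by (rule coset_closed) simp

text \<open>
  The projection onto the quotient and the evaluation of the classes of generators are both
  homomorphisms out of the free group, and they agree on the basis.
\<close>

lemma free_eval_cls:
  assumes "c \<in> carrier F"
  shows "free_eval T cls c = N #>\<^bsub>F\<^esub> c"
proof -
  have e: "free_eval T cls \<in> hom F (add_monoid T)"
    by (rule free_eval_hom) (use T_abelian cls_closed in auto)
  interpret e: group_hom F "add_monoid T" "free_eval T cls"
    using e by (simp add: group_hom_def group_hom_axioms_def T.a_group)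
  interpret q: group_hom F "add_monoid T" "\<lambda>c. N #>\<^bsub>F\<^esub> c"
    using coset_hom by (simp add: group_hom_def group_hom_axioms_def T.a_group)
  from assms have "Poly_Mapping.keys c \<subseteq> G" by simp
  then show ?thesis
  proof (rule free_Abelian_group_induct)
    show "free_eval T cls 0 = N #>\<^bsub>F\<^esub> 0" using e.hom_one q.hom_one by simp
  next
    fix x y assume xy: "Poly_Mapping.keys x \<subseteq> G" "Poly_Mapping.keys y \<subseteq> G"
      "free_eval T cls x = N #>\<^bsub>F\<^esub> x" "free_eval T cls y = N #>\<^bsub>F\<^esub> y"
    show "free_eval T cls (x - y) = N #>\<^bsub>F\<^esub> (x - y)"
      using xy e.hom_mult[of x "inv\<^bsub>F\<^esub> y"] q.hom_mult[of x "inv\<^bsub>F\<^esub> y"] e.hom_inv[of y] q.hom_inv[of y]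
      by simp
  next
    fix a assume "a \<in> G" then show "free_eval T cls (frag_of a) = N #>\<^bsub>F\<^esub> frag_of a"
      by (simp add: free_eval_frag_of T_abelian cls_closed)(simp add: presented_class_def)
  qed
qed

lemma rel_cls: "r \<in> R \<Longrightarrow> free_eval T cls r = \<zero>\<^bsub>T\<^esub>"
proof -
  assume r: "r \<in> R"
  then have "r \<in> N" by (rule generate.incl)
  moreover have "\<zero>\<^bsub>T\<^esub> = N"
    by (simp add: zero_eq FactGroup_def)
  ultimately show ?thesis using r rels
    by (auto simp: free_eval_cls subgroup.rcos_const[OF normal_imp_subgroup[OF N_normal]])
qed

text \<open>
  The kernel of \<open>free_eval P f\<close> is a subgroup that contains the relations, hence also the
  subgroup that they generate.  So the image of a coset is a singleton, and \<open>the_elem\<close> returns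
  its element.
\<close>

lemma lift_coset:
  assumes P: "abelian_group P" and f: "f \<in> G \<rightarrow> carrier P"
    and R: "\<And>r. r \<in> R \<Longrightarrow> free_eval P f r = \<zero>\<^bsub>P\<^esub>" and c: "c \<in> carrier F"
  shows "presented_lift P f (N #>\<^bsub>F\<^esub> c) = free_eval P f c"
proof -
  interpret P: abelian_group P by fact
  interpret e: group_hom F "add_monoid P" "free_eval P f"
    using free_eval_hom[OF P f] by (simp add: group_hom_def group_hom_axioms_def P.a_group)
  have "N \<subseteq> kernel F (add_monoid P) (free_eval P f)"
    by (rule group.generate_subgroup_incl) (use R rels e.subgroup_kernel in \<open>auto simp: kernel_def subset_iff\<close>)
  then have N: "n \<in> carrier F \<and> free_eval P f n = \<zero>\<^bsub>P\<^esub>" if "n \<in> N" for n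
    using that by (auto simp: kernel_def)
  have "free_eval P f (n + c) = free_eval P f c" if "n \<in> N" for n
    using N[OF that] c e.hom_mult[of n c] e.hom_closed[OF c] by simp
  moreover have "0 \<in> N" using generate.one[of F R] by simp
  ultimately have "free_eval P f ` (N #>\<^bsub>F\<^esub> c) = {free_eval P f c}"
    by (auto simp: r_coset_def image_UN)
  then show ?thesis by (simp add: presented_lift_def)
qed

lemma carrierE:
  assumes "X \<in> carrier T" obtains c where "c \<in> carrier F" "X = N #>\<^bsub>F\<^esub> c"
  using assms unfolding carrier_eq by (auto simp: FactGroup_def RCOSETS_def)

lemma lift_add_hom:
  assumes P: "abelian_group P" and f: "f \<in> G \<rightarrow> carrier P"
    and R: "\<And>r. r \<in> R \<Longrightarrow> free_eval P f r = \<zero>\<^bsub>P\<^esub>"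
  shows "presented_lift P f \<in> add_hom T P"
proof (rule add_homI)
  fix X assume "X \<in> carrier T"
  then show "presented_lift P f X \<in> carrier P"
    using hom_in_carrier[OF free_eval_hom[OF P f]] by (auto elim!: carrierE simp: lift_coset[OF P f R])
next
  fix X Y assume "X \<in> carrier T" "Y \<in> carrier T"
  then obtain c d where cd: "c \<in> carrier F" "X = N #>\<^bsub>F\<^esub> c" "d \<in> carrier F" "Y = N #>\<^bsub>F\<^esub> d"
    by (meson carrierE)
  then have "c + d \<in> carrier F" using group.is_monoid[OF group_free_Abelian_group] monoid.m_closed
    by (metis mult_free_Abelian_group)
  then show "presented_lift P f (X \<oplus>\<^bsub>T\<^esub> Y) = presented_lift P f X \<oplus>\<^bsub>P\<^esub> presented_lift P f Y"
    using cd hom_mult[OF free_eval_hom[OF P f], of c d]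
    by (simp only: coset_add lift_coset[OF P f R]) simp
qed

lemma lift_cls:
  assumes P: "abelian_group P" and f: "f \<in> G \<rightarrow> carrier P"
    and R: "\<And>r. r \<in> R \<Longrightarrow> free_eval P f r = \<zero>\<^bsub>P\<^esub>" and x: "x \<in> G"
  shows "presented_lift P f (cls x) = f x"
  unfolding presented_class_def using lift_coset[OF P f R, of "frag_of x"] x f
  by (auto simp: free_eval_frag_of P Pi_iff)

text \<open>
  This is the uniqueness half of the universal property of a presentation.  Nearly every identity
  below is proved with it: both sides are additive, so they are compared on generators only.
\<close>

lemma add_hom_eq_on_classes:
  assumes P: "abelian_group P" and h: "h \<in> add_hom T P" and k: "k \<in> add_hom T P"
    and eq: "\<And>x. x \<in> G \<Longrightarrow> h (cls x) = k (cls x)" and X: "X \<in> carrier T"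
  shows "h X = k X"
proof -
  interpret P: abelian_group P by fact
  interpret h: group_hom "add_monoid T" "add_monoid P" h
    using h by (simp add: group_hom_def group_hom_axioms_def T.a_group P.a_group add_hom_iff_hom)
  interpret k: group_hom "add_monoid T" "add_monoid P" k
    using k by (simp add: group_hom_def group_hom_axioms_def T.a_group P.a_group add_hom_iff_hom)
  interpret q: group_hom F "add_monoid T" "\<lambda>c. N #>\<^bsub>F\<^esub> c"
    using coset_hom by (simp add: group_hom_def group_hom_axioms_def T.a_group)
  obtain c where "Poly_Mapping.keys c \<subseteq> G" and Xc: "X = N #>\<^bsub>F\<^esub> c"
    using X by (auto elim: carrierE)
  from this(1) have "h (N #>\<^bsub>F\<^esub> c) = k (N #>\<^bsub>F\<^esub> c)"
  proof (rule free_Abelian_group_induct)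
    show "h (N #>\<^bsub>F\<^esub> 0) = k (N #>\<^bsub>F\<^esub> 0)" using q.hom_one h.hom_one k.hom_one by simp
  next
    fix x y assume 2: "Poly_Mapping.keys x \<subseteq> G" "Poly_Mapping.keys y \<subseteq> G"
      "h (N #>\<^bsub>F\<^esub> x) = k (N #>\<^bsub>F\<^esub> x)" "h (N #>\<^bsub>F\<^esub> y) = k (N #>\<^bsub>F\<^esub> y)"
    have "N #>\<^bsub>F\<^esub> (x - y) = (N #>\<^bsub>F\<^esub> x) \<ominus>\<^bsub>T\<^esub> (N #>\<^bsub>F\<^esub> y)"
      using 2 q.hom_mult[of x "inv\<^bsub>F\<^esub> y"] q.hom_inv[of y]
      by (simp add: a_minus_def a_inv_def)
    moreover have "N #>\<^bsub>F\<^esub> x \<in> carrier T" "N #>\<^bsub>F\<^esub> y \<in> carrier T" using 2 coset_closed by auto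
    ultimately show "h (N #>\<^bsub>F\<^esub> (x - y)) = k (N #>\<^bsub>F\<^esub> (x - y))" using 2 h.hom_inv k.hom_inv
      by (simp add: a_minus_def a_inv_def add_hom_add[OF h] add_hom_add[OF k] T.add.inv_closed)
  next
    fix a assume "a \<in> G" then show "h (N #>\<^bsub>F\<^esub> frag_of a) = k (N #>\<^bsub>F\<^esub> frag_of a)" using eq by (simp add: presented_class_def)
  qed
  then show ?thesis using Xc by simp
qed

end

lemma presents_presented_group:
  "R \<subseteq> carrier (free_Abelian_group G) \<Longrightarrow> presents (presented_group G R) G R"
  by unfold_locales (auto simp: presented_group_def Let_def)

lemma presents_presented_module:
  "R \<subseteq> carrier (free_Abelian_group G) \<Longrightarrow> presents (presented_module G R act) G R"
  by unfold_locales (auto simp: presented_module_def presented_group_def Let_def ring.defs)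

lemma minus_eq_zero_iff:
  assumes "abelian_group P" "x \<in> carrier P" "y \<in> carrier P"
  shows "x \<ominus>\<^bsub>P\<^esub> y = \<zero>\<^bsub>P\<^esub> \<longleftrightarrow> x = y"
proof -
  interpret P: abelian_group P by fact
  show ?thesis using assms(2,3) P.minus_equality P.minus_minus P.r_neg
    by (metis P.a_inv_closed a_minus_def)
qed

lemma free_eval_diff:
  assumes "abelian_group P" "f \<in> G \<rightarrow> carrier P" "Poly_Mapping.keys c \<subseteq> G" "Poly_Mapping.keys d \<subseteq> G"
  shows "free_eval P f (c - d) = free_eval P f c \<ominus>\<^bsub>P\<^esub> free_eval P f d"
proof -
  interpret P: abelian_group P by fact
  interpret e: group_hom "free_Abelian_group G" "add_monoid P" "free_eval P f"
    using free_eval_hom[OF assms(1,2)] by (simp add: group_hom_def group_hom_axioms_def P.a_group)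
  show ?thesis
    using assms(3,4) e.hom_mult[of c "inv\<^bsub>free_Abelian_group G\<^esub> d"] e.hom_inv[of d]
    by (simp add: a_minus_def a_inv_def)
qed

text \<open>
  The relations of tensor products and of Kaehler modules are differences of two or three basis
  elements.  The two equivalences below translate the vanishing of such a relation into an equation.
\<close>

lemma free_eval_diff_eq_zero_iff:
  assumes "abelian_group P" "f \<in> G \<rightarrow> carrier P" "a \<in> G" "b \<in> G"
  shows "free_eval P f (frag_of a - frag_of b) = \<zero>\<^bsub>P\<^esub> \<longleftrightarrow> f a = f b"
proof -
  interpret P: abelian_group P by fact
  have "f a \<in> carrier P" "f b \<in> carrier P" using assms by auto
  then show ?thesis using assms
    by (simp add: free_eval_diff[of P f G] free_eval_frag_of minus_eq_zero_iff[OF P.abelian_group_axioms])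
qed

lemma free_eval_diff2_eq_zero_iff:
  assumes "abelian_group P" "f \<in> G \<rightarrow> carrier P" "a \<in> G" "b \<in> G" "c \<in> G"
  shows "free_eval P f (frag_of a - frag_of b - frag_of c) = \<zero>\<^bsub>P\<^esub> \<longleftrightarrow> f a = f b \<oplus>\<^bsub>P\<^esub> f c"
proof -
  interpret P: abelian_group P by fact
  have f: "f a \<in> carrier P" "f b \<in> carrier P" "f c \<in> carrier P" using assms by auto
  have k: "Poly_Mapping.keys (frag_of a - frag_of b) \<subseteq> G"
    using keys_diff[of "frag_of a" "frag_of b"] assms by auto
  have "free_eval P f (frag_of a - frag_of b - frag_of c) = (f a \<ominus>\<^bsub>P\<^esub> f b) \<ominus>\<^bsub>P\<^esub> f c"
    using assms f k by (simp add: free_eval_diff[of P f G] free_eval_frag_of)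
  also have "\<dots> = f a \<ominus>\<^bsub>P\<^esub> (f b \<oplus>\<^bsub>P\<^esub> f c)"
    using f by (simp add: P.minus_add a_minus_def P.a_assoc)
  finally show ?thesis using f by (simp add: minus_eq_zero_iff[OF P.abelian_group_axioms])
qed

lemma keys_diff_frag_of:
  assumes "a \<in> G" "b \<in> G" shows "Poly_Mapping.keys (frag_of a - frag_of b) \<subseteq> G"
  using keys_diff[of "frag_of a" "frag_of b"] assms by auto

lemma keys_diff2_frag_of:
  assumes "a \<in> G" "b \<in> G" "c \<in> G"
  shows "Poly_Mapping.keys (frag_of a - frag_of b - frag_of c) \<subseteq> G"
  using keys_diff[of "frag_of a - frag_of b" "frag_of c"] keys_diff_frag_of[of a G b] assms by auto

section \<open>Presented modules\<close>

lemma presented_module_simps: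
  "carrier (presented_module G R act) = carrier (presented_group G R)"
  "add (presented_module G R act) = add (presented_group G R)"
  "\<zero>\<^bsub>presented_module G R act\<^esub> = \<zero>\<^bsub>presented_group G R\<^esub>"
  "r \<odot>\<^bsub>presented_module G R act\<^esub> X =
     presented_lift (presented_group G R) (\<lambda>x. presented_class G R (act r x)) X"
  by (simp_all add: presented_module_def ring.defs module.defs)

text \<open>
  Every module axiom is an equation between additive maps of the presented group, so it suffices
  to know the action on generators.  The hypothesis on relations makes each scalar well defined.
\<close>

lemma
  fixes H :: "('r, 'z) ring_scheme" and act :: "'r \<Rightarrow> 'x \<Rightarrow> 'x"
  assumes H: "cring H" and R: "R \<subseteq> carrier (free_Abelian_group G)"
    and act_closed: "\<And>r x. r \<in> carrier H \<Longrightarrow> x \<in> G \<Longrightarrow> act r x \<in> G"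
    and act_rels: "\<And>r q. r \<in> carrier H \<Longrightarrow> q \<in> R \<Longrightarrow>
      free_eval (presented_group G R) (\<lambda>x. presented_class G R (act r x)) q = \<zero>\<^bsub>presented_group G R\<^esub>"
    and act_add: "\<And>r r' x. r \<in> carrier H \<Longrightarrow> r' \<in> carrier H \<Longrightarrow> x \<in> G \<Longrightarrow>
      presented_class G R (act (r \<oplus>\<^bsub>H\<^esub> r') x) =
      presented_class G R (act r x) \<oplus>\<^bsub>presented_group G R\<^esub> presented_class G R (act r' x)"
    and act_mult: "\<And>r r' x. r \<in> carrier H \<Longrightarrow> r' \<in> carrier H \<Longrightarrow> x \<in> G \<Longrightarrow>
      act (r \<otimes>\<^bsub>H\<^esub> r') x = act r (act r' x)"
    and act_one: "\<And>x. x \<in> G \<Longrightarrow> act \<one>\<^bsub>H\<^esub> x = x"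
  shows presented_module_is_module: "module H (presented_module G R act)"
    and presented_module_smult_class: "\<And>r x. r \<in> carrier H \<Longrightarrow> x \<in> G \<Longrightarrow>
      r \<odot>\<^bsub>presented_module G R act\<^esub> presented_class G R x = presented_class G R (act r x)"
proof -
  interpret H: cring H by fact
  let ?M = "presented_module G R act" and ?Q = "presented_group G R"
  interpret Q: presents ?Q G R by (rule presents_presented_group[OF R])
  interpret M: presents ?M G R by (rule presents_presented_module[OF R])
  have f: "(\<lambda>x. Q.cls (act r x)) \<in> G \<rightarrow> carrier ?Q" if "r \<in> carrier H" for r
    using that act_closed Q.cls_closed by auto
  have hom: "(\<lambda>X. r \<odot>\<^bsub>?M\<^esub> X) \<in> add_hom ?Q ?Q" if "r \<in> carrier H" for r
    unfolding presented_module_simps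
    using Q.lift_add_hom[OF Q.T_abelian f act_rels] that by (simp add: add_hom_def)
  show smult_cls: "r \<odot>\<^bsub>?M\<^esub> Q.cls x = Q.cls (act r x)" if "r \<in> carrier H" "x \<in> G" for r x
    unfolding presented_module_simps using Q.lift_cls[OF Q.T_abelian f act_rels] that by blast
  note eqI = Q.add_hom_eq_on_classes[OF Q.T_abelian]
  show "module H ?M"
  proof (rule moduleI[OF H M.T_abelian], unfold presented_module_simps(1,2))
    fix a X assume "a \<in> carrier H" "X \<in> carrier ?Q"
    then show "a \<odot>\<^bsub>?M\<^esub> X \<in> carrier ?Q" by (rule add_hom_closed[OF hom])
  next
    fix a b X assume "a \<in> carrier H" "b \<in> carrier H" "X \<in> carrier ?Q"
    note ax = this
    show "(a \<oplus>\<^bsub>H\<^esub> b) \<odot>\<^bsub>?M\<^esub> X = a \<odot>\<^bsub>?M\<^esub> X \<oplus>\<^bsub>?Q\<^esub> b \<odot>\<^bsub>?M\<^esub> X"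
      by (rule eqI[of "\<lambda>X. (a \<oplus>\<^bsub>H\<^esub> b) \<odot>\<^bsub>?M\<^esub> X" "\<lambda>X. a \<odot>\<^bsub>?M\<^esub> X \<oplus>\<^bsub>?Q\<^esub> b \<odot>\<^bsub>?M\<^esub> X"])
        (simp_all add: ax hom add_hom_pointwise_add Q.T_abelian smult_cls act_add)
  next
    fix a X Y assume "a \<in> carrier H" "X \<in> carrier ?Q" "Y \<in> carrier ?Q"
    then show "a \<odot>\<^bsub>?M\<^esub> (X \<oplus>\<^bsub>?Q\<^esub> Y) = a \<odot>\<^bsub>?M\<^esub> X \<oplus>\<^bsub>?Q\<^esub> a \<odot>\<^bsub>?M\<^esub> Y"
      by (rule add_hom_add[OF hom])
  next
    fix a b X assume "a \<in> carrier H" "b \<in> carrier H" "X \<in> carrier ?Q"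
    note ax = this
    show "(a \<otimes>\<^bsub>H\<^esub> b) \<odot>\<^bsub>?M\<^esub> X = a \<odot>\<^bsub>?M\<^esub> (b \<odot>\<^bsub>?M\<^esub> X)"
      by (rule eqI[of "\<lambda>X. (a \<otimes>\<^bsub>H\<^esub> b) \<odot>\<^bsub>?M\<^esub> X" "\<lambda>X. a \<odot>\<^bsub>?M\<^esub> (b \<odot>\<^bsub>?M\<^esub> X)"])
        (simp_all add: ax hom add_hom_comp[OF hom hom] smult_cls act_mult act_closed)
  next
    fix X assume "X \<in> carrier ?Q"
    note ax = this
    show "\<one>\<^bsub>H\<^esub> \<odot>\<^bsub>?M\<^esub> X = X"
      by (rule eqI[of "\<lambda>X. \<one>\<^bsub>H\<^esub> \<odot>\<^bsub>?M\<^esub> X" "\<lambda>X. X"])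
        (simp_all add: ax hom smult_cls act_one add_homI)
  qed
qed

section \<open>Tensor products\<close>

definition balanced ::
  "('a, 'z) ring_scheme \<Rightarrow> ('a, 'm) module \<Rightarrow> ('a, 'n) module \<Rightarrow> ('p, 'r) ring_scheme \<Rightarrow>
     ('m \<Rightarrow> 'n \<Rightarrow> 'p) \<Rightarrow> bool" where
  "balanced A M N P f \<longleftrightarrow>
    (\<forall>x\<in>carrier M. \<forall>y\<in>carrier N. f x y \<in> carrier P) \<and>
    (\<forall>x\<in>carrier M. \<forall>x'\<in>carrier M. \<forall>y\<in>carrier N. f (x \<oplus>\<^bsub>M\<^esub> x') y = f x y \<oplus>\<^bsub>P\<^esub> f x' y) \<and>
    (\<forall>x\<in>carrier M. \<forall>y\<in>carrier N. \<forall>y'\<in>carrier N. f x (y \<oplus>\<^bsub>N\<^esub> y') = f x y \<oplus>\<^bsub>P\<^esub> f x y') \<and>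
    (\<forall>a\<in>carrier A. \<forall>x\<in>carrier M. \<forall>y\<in>carrier N. f (a \<odot>\<^bsub>M\<^esub> x) y = f x (a \<odot>\<^bsub>N\<^esub> y))"

lemma balancedI:
  assumes "\<And>x y. x \<in> carrier M \<Longrightarrow> y \<in> carrier N \<Longrightarrow> f x y \<in> carrier P"
    and "\<And>x x' y. x \<in> carrier M \<Longrightarrow> x' \<in> carrier M \<Longrightarrow> y \<in> carrier N \<Longrightarrow>
      f (x \<oplus>\<^bsub>M\<^esub> x') y = f x y \<oplus>\<^bsub>P\<^esub> f x' y"
    and "\<And>x y y'. x \<in> carrier M \<Longrightarrow> y \<in> carrier N \<Longrightarrow> y' \<in> carrier N \<Longrightarrow>
      f x (y \<oplus>\<^bsub>N\<^esub> y') = f x y \<oplus>\<^bsub>P\<^esub> f x y'"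
    and "\<And>a x y. a \<in> carrier A \<Longrightarrow> x \<in> carrier M \<Longrightarrow> y \<in> carrier N \<Longrightarrow>
      f (a \<odot>\<^bsub>M\<^esub> x) y = f x (a \<odot>\<^bsub>N\<^esub> y)"
  shows "balanced A M N P f"
  using assms by (simp add: balanced_def)

lemma balancedD:
  assumes "balanced A M N P f"
  shows "x \<in> carrier M \<Longrightarrow> y \<in> carrier N \<Longrightarrow> f x y \<in> carrier P"
    and "x \<in> carrier M \<Longrightarrow> x' \<in> carrier M \<Longrightarrow> y \<in> carrier N \<Longrightarrow>
      f (x \<oplus>\<^bsub>M\<^esub> x') y = f x y \<oplus>\<^bsub>P\<^esub> f x' y"
    and "x \<in> carrier M \<Longrightarrow> y \<in> carrier N \<Longrightarrow> y' \<in> carrier N \<Longrightarrow>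
      f x (y \<oplus>\<^bsub>N\<^esub> y') = f x y \<oplus>\<^bsub>P\<^esub> f x y'"
    and "a \<in> carrier A \<Longrightarrow> x \<in> carrier M \<Longrightarrow> y \<in> carrier N \<Longrightarrow>
      f (a \<odot>\<^bsub>M\<^esub> x) y = f x (a \<odot>\<^bsub>N\<^esub> y)"
  using assms by (simp_all add: balanced_def)

lemma balanced_add_hom:
  assumes "balanced A M N P f" "h \<in> add_hom P Q"
  shows "balanced A M N Q (\<lambda>x y. h (f x y))"
  using assms by (intro balancedI) (simp_all add: balancedD add_hom_closed add_hom_add)

lemma balanced_pointwise_add:
  assumes P: "abelian_group P" and f: "balanced A M N P f" and g: "balanced A M N P g"
  shows "balanced A M N P (\<lambda>x y. f x y \<oplus>\<^bsub>P\<^esub> g x y)"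
proof -
  interpret P: abelian_group P by fact
  show ?thesis
    by (intro balancedI) (simp_all add: balancedD[OF f] balancedD[OF g] P.a_ac)
qed

text \<open>
  The presentation of a tensor product makes sense as soon as the factors are closed under addition
  and scalars.  Asking for no more allows \<open>I/I\<^sup>2\<close> and \<open>H \<otimes>\<^sub>A H\<close> to be used as
  factors before any module axiom has been checked for them.
\<close>

locale tensor_factors =
  fixes A :: "('a, 'z) ring_scheme" and M :: "('a, 'm) module" and N :: "('a, 'n) module"
  assumes M_add: "\<And>x x'. x \<in> carrier M \<Longrightarrow> x' \<in> carrier M \<Longrightarrow> x \<oplus>\<^bsub>M\<^esub> x' \<in> carrier M"
    and M_smult: "\<And>a x. a \<in> carrier A \<Longrightarrow> x \<in> carrier M \<Longrightarrow> a \<odot>\<^bsub>M\<^esub> x \<in> carrier M"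
    and N_add: "\<And>y y'. y \<in> carrier N \<Longrightarrow> y' \<in> carrier N \<Longrightarrow> y \<oplus>\<^bsub>N\<^esub> y' \<in> carrier N"
    and N_smult: "\<And>a y. a \<in> carrier A \<Longrightarrow> y \<in> carrier N \<Longrightarrow> a \<odot>\<^bsub>N\<^esub> y \<in> carrier N"
begin

lemma tensor_rels_carrier:
  "tensor_rels A M N \<subseteq> carrier (free_Abelian_group (carrier M \<times> carrier N))"
proof
  fix r assume "r \<in> tensor_rels A M N"
  then have "Poly_Mapping.keys r \<subseteq> carrier M \<times> carrier N"
    unfolding tensor_rels_def
    by (elim UnE CollectE exE conjE; simp only:)
      (rule keys_diff_frag_of keys_diff2_frag_of; simp add: M_add M_smult N_add N_smult)+
  then show "r \<in> carrier (free_Abelian_group (carrier M \<times> carrier N))" by simp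
qed

text \<open>
  Read from right to left this gives the lift of a balanced map; read from left to right, and applied
  to the classes of generators, it says that the pure tensors themselves form a balanced map.
\<close>

lemma rels_zero_iff_balanced:
  assumes P: "abelian_group P"
    and f: "\<And>x y. x \<in> carrier M \<Longrightarrow> y \<in> carrier N \<Longrightarrow> f (x, y) \<in> carrier P"
  shows "(\<forall>r\<in>tensor_rels A M N. free_eval P f r = \<zero>\<^bsub>P\<^esub>) \<longleftrightarrow>
    balanced A M N P (\<lambda>x y. f (x, y))"
proof -
  have f': "f \<in> carrier M \<times> carrier N \<rightarrow> carrier P" using f by auto
  note z = free_eval_diff_eq_zero_iff[OF P f'] free_eval_diff2_eq_zero_iff[OF P f']
  show ?thesis
  proof
    assume *: "\<forall>r\<in>tensor_rels A M N. free_eval P f r = \<zero>\<^bsub>P\<^esub>"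
    show "balanced A M N P (\<lambda>x y. f (x, y))"
    proof (rule balancedI)
      fix x x' y assume "x \<in> carrier M" "x' \<in> carrier M" "y \<in> carrier N"
      moreover from this have "frag_of (x \<oplus>\<^bsub>M\<^esub> x', y) - frag_of (x, y) - frag_of (x', y) \<in> tensor_rels A M N"
        unfolding tensor_rels_def by blast
      ultimately show "f (x \<oplus>\<^bsub>M\<^esub> x', y) = f (x, y) \<oplus>\<^bsub>P\<^esub> f (x', y)"
        using * by (intro z(2)[THEN iffD1]) (auto simp: M_add)
    next
      fix x y y' assume "x \<in> carrier M" "y \<in> carrier N" "y' \<in> carrier N"
      moreover from this have "frag_of (x, y \<oplus>\<^bsub>N\<^esub> y') - frag_of (x, y) - frag_of (x, y') \<in> tensor_rels A M N"
        unfolding tensor_rels_def by blast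
      ultimately show "f (x, y \<oplus>\<^bsub>N\<^esub> y') = f (x, y) \<oplus>\<^bsub>P\<^esub> f (x, y')"
        using * by (intro z(2)[THEN iffD1]) (auto simp: N_add)
    next
      fix a x y assume "a \<in> carrier A" "x \<in> carrier M" "y \<in> carrier N"
      moreover from this have "frag_of (a \<odot>\<^bsub>M\<^esub> x, y) - frag_of (x, a \<odot>\<^bsub>N\<^esub> y) \<in> tensor_rels A M N"
        unfolding tensor_rels_def by blast
      ultimately show "f (a \<odot>\<^bsub>M\<^esub> x, y) = f (x, a \<odot>\<^bsub>N\<^esub> y)"
        using * by (intro z(1)[THEN iffD1]) (auto simp: M_smult N_smult)
    qed (rule f)
  next
    assume b: "balanced A M N P (\<lambda>x y. f (x, y))"
    show "\<forall>r\<in>tensor_rels A M N. free_eval P f r = \<zero>\<^bsub>P\<^esub>"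
    proof
      fix r assume "r \<in> tensor_rels A M N"
      then show "free_eval P f r = \<zero>\<^bsub>P\<^esub>"
        unfolding tensor_rels_def
        by (elim UnE CollectE exE conjE; simp only:)
          ((rule z[THEN iffD2]; simp add: balancedD[OF b] M_add M_smult N_add N_smult)+)
    qed
  qed
qed

end

locale tensor_product = tensor_factors A M N + presents T "carrier M \<times> carrier N" "tensor_rels A M N"
  for A :: "('a, 'z) ring_scheme" and M :: "('a, 'm) module" and N :: "('a, 'n) module"
    and T :: "(('m \<times> 'n \<Rightarrow>\<^sub>0 int) set, 't) ring_scheme"
begin

abbreviation "pure \<equiv> pure_tensor A M N"

lemma pure_balanced: "balanced A M N T pure"
  using rels_zero_iff_balanced[OF T_abelian, of cls] rel_cls cls_closed
  by (auto simp: pure_tensor_def[abs_def])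

lemma pure_closed: "x \<in> carrier M \<Longrightarrow> y \<in> carrier N \<Longrightarrow> pure x y \<in> carrier T"
  using balancedD(1)[OF pure_balanced] .

lemma tensor_lift_hom:
  assumes "abelian_group P" "balanced A M N P f"
  shows "tensor_lift P f \<in> add_hom T P"
  unfolding tensor_lift_def using rels_zero_iff_balanced[of P "\<lambda>(x, y). f x y"] assms
  by (intro lift_add_hom) (auto simp: balancedD(1))

lemma tensor_lift_pure:
  assumes "abelian_group P" "balanced A M N P f" "x \<in> carrier M" "y \<in> carrier N"
  shows "tensor_lift P f (pure x y) = f x y"
  unfolding tensor_lift_def pure_tensor_def
  using rels_zero_iff_balanced[of P "\<lambda>(x, y). f x y"] assms
  by (subst lift_cls) (auto simp: balancedD(1))

lemma add_hom_eq_on_pure: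
  assumes "abelian_group P" "h \<in> add_hom T P" "k \<in> add_hom T P"
    and "\<And>x y. x \<in> carrier M \<Longrightarrow> y \<in> carrier N \<Longrightarrow> h (pure x y) = k (pure x y)"
    and "X \<in> carrier T"
  shows "h X = k X"
  by (rule add_hom_eq_on_classes[of P h k]) (use assms in \<open>auto simp: pure_tensor_def\<close>)

lemma tensor_lift_closed:
  "abelian_group P \<Longrightarrow> balanced A M N P f \<Longrightarrow> X \<in> carrier T \<Longrightarrow> tensor_lift P f X \<in> carrier P"
  by (rule add_hom_closed[OF tensor_lift_hom])

lemma tensor_lift_eq:
  assumes "abelian_group P" "balanced A M N P f" "h \<in> add_hom T P"
    and "\<And>x y. x \<in> carrier M \<Longrightarrow> y \<in> carrier N \<Longrightarrow> f x y = h (pure x y)"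
    and "X \<in> carrier T"
  shows "tensor_lift P f X = h X"
  by (rule add_hom_eq_on_pure[OF assms(1) tensor_lift_hom[OF assms(1,2)] assms(3) _ assms(5)])
    (simp add: tensor_lift_pure assms)

lemma tensor_lift_cong:
  assumes "abelian_group P" "balanced A M N P f" "balanced A M N P g"
    and "\<And>x y. x \<in> carrier M \<Longrightarrow> y \<in> carrier N \<Longrightarrow> f x y = g x y"
    and "X \<in> carrier T"
  shows "tensor_lift P f X = tensor_lift P g X"
  by (rule tensor_lift_eq[OF assms(1,2) tensor_lift_hom[OF assms(1,3)] _ assms(5)])
    (simp add: tensor_lift_pure assms)

lemma add_hom_tensor_lift:
  assumes "abelian_group P" "abelian_group Q" "balanced A M N P f" "h \<in> add_hom P Q" "X \<in> carrier T"
  shows "h (tensor_lift P f X) = tensor_lift Q (\<lambda>x y. h (f x y)) X"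
  by (rule tensor_lift_eq[OF assms(2) balanced_add_hom[OF assms(3,4)]
        add_hom_comp[OF tensor_lift_hom[OF assms(1,3)] assms(4)] _ assms(5), symmetric])
    (simp add: tensor_lift_pure assms)

text \<open>
  Iterated lifts need additivity of \<open>tensor_lift P f X\<close> in \<open>f\<close>, not only in \<open>X\<close>: when
  \<open>f\<close> depends on a further variable, the lift is again balanced in that variable.
\<close>

lemma tensor_lift_add:
  assumes P: "abelian_group P" and f: "balanced A M N P f" and g: "balanced A M N P g"
    and k: "\<And>x y. x \<in> carrier M \<Longrightarrow> y \<in> carrier N \<Longrightarrow> k x y = f x y \<oplus>\<^bsub>P\<^esub> g x y"
    and kb: "balanced A M N P k" and X: "X \<in> carrier T"
  shows "tensor_lift P k X = tensor_lift P f X \<oplus>\<^bsub>P\<^esub> tensor_lift P g X"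
  by (rule tensor_lift_eq[where h = "\<lambda>X. tensor_lift P f X \<oplus>\<^bsub>P\<^esub> tensor_lift P g X"])
    (use assms in \<open>auto simp: tensor_lift_hom tensor_lift_pure balanced_pointwise_add add_hom_pointwise_add\<close>)

end

lemma (in tensor_factors) tensor_product_tensor_module:
  "tensor_product A M N (tensor_module A act M N)"
  unfolding tensor_module_def tensor_product_def
  using tensor_factors_axioms presents_presented_module[OF tensor_rels_carrier] by blast

lemma (in tensor_factors) tensor_product_tensor_algebra:
  "tensor_product A M N (tensor_algebra A act M N)"
  using tensor_product_tensor_module[of act]
  by (simp add: tensor_product_def tensor_algebra_def presents_def)

context tensor_factors
begin

context
  fixes H :: "('r, 'w) ring_scheme" and act :: "'r \<Rightarrow> 'm \<Rightarrow> 'm"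
  assumes H: "cring H"
    and act_closed: "\<And>r x. r \<in> carrier H \<Longrightarrow> x \<in> carrier M \<Longrightarrow> act r x \<in> carrier M"
    and act_add: "\<And>r x x'. r \<in> carrier H \<Longrightarrow> x \<in> carrier M \<Longrightarrow> x' \<in> carrier M \<Longrightarrow>
      act r (x \<oplus>\<^bsub>M\<^esub> x') = act r x \<oplus>\<^bsub>M\<^esub> act r x'"
    and act_smult: "\<And>r a x. r \<in> carrier H \<Longrightarrow> a \<in> carrier A \<Longrightarrow> x \<in> carrier M \<Longrightarrow>
      act r (a \<odot>\<^bsub>M\<^esub> x) = a \<odot>\<^bsub>M\<^esub> act r x"
    and act_l_distr: "\<And>r r' x. r \<in> carrier H \<Longrightarrow> r' \<in> carrier H \<Longrightarrow> x \<in> carrier M \<Longrightarrow>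
      act (r \<oplus>\<^bsub>H\<^esub> r') x = act r x \<oplus>\<^bsub>M\<^esub> act r' x"
    and act_mult: "\<And>r r' x. r \<in> carrier H \<Longrightarrow> r' \<in> carrier H \<Longrightarrow> x \<in> carrier M \<Longrightarrow>
      act (r \<otimes>\<^bsub>H\<^esub> r') x = act r (act r' x)"
    and act_one: "\<And>x. x \<in> carrier M \<Longrightarrow> act \<one>\<^bsub>H\<^esub> x = x"
begin

lemma
  shows tensor_module_is_module: "module H (tensor_module A act M N)"
    and tensor_module_smult_pure: "\<And>r x y. r \<in> carrier H \<Longrightarrow> x \<in> carrier M \<Longrightarrow> y \<in> carrier N \<Longrightarrow>
      r \<odot>\<^bsub>tensor_module A act M N\<^esub> pure_tensor A M N x y = pure_tensor A M N (act r x) y"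
proof -
  let ?G = "carrier M \<times> carrier N" and ?R = "tensor_rels A M N"
  let ?Q = "presented_group ?G ?R"
  interpret Q: tensor_product A M N ?Q
    using tensor_factors_axioms presents_presented_group[OF tensor_rels_carrier]
    by (simp add: tensor_product_def)
  note pd = balancedD[OF Q.pure_balanced, unfolded pure_tensor_def]
  have act_rels: "free_eval ?Q (\<lambda>x. Q.cls (case x of (x, y) \<Rightarrow> (act r x, y))) q = \<zero>\<^bsub>?Q\<^esub>"
    if "r \<in> carrier H" "q \<in> ?R" for r q
  proof -
    have "balanced A M N ?Q (\<lambda>x y. Q.cls (case (x, y) of (x, y) \<Rightarrow> (act r x, y)))"
      using that by (intro balancedI) (simp_all add: act_closed act_add act_smult pd)
    then show ?thesis
      using rels_zero_iff_balanced[OF Q.T_abelian, of "\<lambda>x. Q.cls (case x of (x, y) \<Rightarrow> (act r x, y))"] that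
      by (simp add: act_closed pd)
  qed
  note pm = presented_module_is_module[OF H tensor_rels_carrier, of "\<lambda>r (x, y). (act r x, y)"]
    presented_module_smult_class[OF H tensor_rels_carrier, of "\<lambda>r (x, y). (act r x, y)"]
  show "module H (tensor_module A act M N)"
    unfolding tensor_module_def
    by (rule pm(1)) (use act_rels in \<open>auto simp: act_closed act_l_distr act_mult act_one pd\<close>)
  show "r \<odot>\<^bsub>tensor_module A act M N\<^esub> pure_tensor A M N x y = pure_tensor A M N (act r x) y"
    if "r \<in> carrier H" "x \<in> carrier M" "y \<in> carrier N" for r x y
    unfolding tensor_module_def pure_tensor_def
    by (subst pm(2)) (use act_rels that in \<open>auto simp: act_closed act_l_distr act_mult act_one pd\<close>)
qed

end

lemma tensor_algebra_simps:
  "carrier (tensor_algebra A act M N) = carrier (tensor_module A act M N)"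
  "add (tensor_algebra A act M N) = add (tensor_module A act M N)"
  by (simp_all add: tensor_algebra_def)

context
  fixes T act
  assumes M_mult: "\<And>x x'. x \<in> carrier M \<Longrightarrow> x' \<in> carrier M \<Longrightarrow> x \<otimes>\<^bsub>M\<^esub> x' \<in> carrier M"
    and M_l_distr: "\<And>x x' z. x \<in> carrier M \<Longrightarrow> x' \<in> carrier M \<Longrightarrow> z \<in> carrier M \<Longrightarrow>
      (x \<oplus>\<^bsub>M\<^esub> x') \<otimes>\<^bsub>M\<^esub> z = x \<otimes>\<^bsub>M\<^esub> z \<oplus>\<^bsub>M\<^esub> x' \<otimes>\<^bsub>M\<^esub> z"
    and M_r_distr: "\<And>x x' z. x \<in> carrier M \<Longrightarrow> x' \<in> carrier M \<Longrightarrow> z \<in> carrier M \<Longrightarrow>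
      z \<otimes>\<^bsub>M\<^esub> (x \<oplus>\<^bsub>M\<^esub> x') = z \<otimes>\<^bsub>M\<^esub> x \<oplus>\<^bsub>M\<^esub> z \<otimes>\<^bsub>M\<^esub> x'"
    and M_smult_l: "\<And>a x x'. a \<in> carrier A \<Longrightarrow> x \<in> carrier M \<Longrightarrow> x' \<in> carrier M \<Longrightarrow>
      (a \<odot>\<^bsub>M\<^esub> x) \<otimes>\<^bsub>M\<^esub> x' = a \<odot>\<^bsub>M\<^esub> (x \<otimes>\<^bsub>M\<^esub> x')"
    and M_smult_r: "\<And>a x x'. a \<in> carrier A \<Longrightarrow> x \<in> carrier M \<Longrightarrow> x' \<in> carrier M \<Longrightarrow>
      x \<otimes>\<^bsub>M\<^esub> (a \<odot>\<^bsub>M\<^esub> x') = a \<odot>\<^bsub>M\<^esub> (x \<otimes>\<^bsub>M\<^esub> x')"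
    and N_mult: "\<And>x x'. x \<in> carrier N \<Longrightarrow> x' \<in> carrier N \<Longrightarrow> x \<otimes>\<^bsub>N\<^esub> x' \<in> carrier N"
    and N_l_distr: "\<And>x x' z. x \<in> carrier N \<Longrightarrow> x' \<in> carrier N \<Longrightarrow> z \<in> carrier N \<Longrightarrow>
      (x \<oplus>\<^bsub>N\<^esub> x') \<otimes>\<^bsub>N\<^esub> z = x \<otimes>\<^bsub>N\<^esub> z \<oplus>\<^bsub>N\<^esub> x' \<otimes>\<^bsub>N\<^esub> z"
    and N_r_distr: "\<And>x x' z. x \<in> carrier N \<Longrightarrow> x' \<in> carrier N \<Longrightarrow> z \<in> carrier N \<Longrightarrow>
      z \<otimes>\<^bsub>N\<^esub> (x \<oplus>\<^bsub>N\<^esub> x') = z \<otimes>\<^bsub>N\<^esub> x \<oplus>\<^bsub>N\<^esub> z \<otimes>\<^bsub>N\<^esub> x'"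
    and N_smult_l: "\<And>a x x'. a \<in> carrier A \<Longrightarrow> x \<in> carrier N \<Longrightarrow> x' \<in> carrier N \<Longrightarrow>
      (a \<odot>\<^bsub>N\<^esub> x) \<otimes>\<^bsub>N\<^esub> x' = a \<odot>\<^bsub>N\<^esub> (x \<otimes>\<^bsub>N\<^esub> x')"
    and N_smult_r: "\<And>a x x'. a \<in> carrier A \<Longrightarrow> x \<in> carrier N \<Longrightarrow> x' \<in> carrier N \<Longrightarrow>
      x \<otimes>\<^bsub>N\<^esub> (a \<odot>\<^bsub>N\<^esub> x') = a \<odot>\<^bsub>N\<^esub> (x \<otimes>\<^bsub>N\<^esub> x')"
    and T_def: "T = tensor_algebra A act M N"
begin

text \<open>
  The product on a tensor algebra is a lift inside a lift.  The inner lift \<open>B x y\<close> multiplies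
  by \<open>x \<otimes> y\<close>; it depends on \<open>x\<close> and \<open>y\<close> in a balanced way because it is an additive map
  that is determined on pure tensors.
\<close>

lemma
  shows tensor_algebra_mult_l: "\<And>V. V \<in> carrier T \<Longrightarrow> (\<lambda>U. U \<otimes>\<^bsub>T\<^esub> V) \<in> add_hom T T"
    and tensor_algebra_mult_r: "\<And>U. U \<in> carrier T \<Longrightarrow> (\<lambda>V. U \<otimes>\<^bsub>T\<^esub> V) \<in> add_hom T T"
    and tensor_algebra_mult_pure:
      "\<And>x y x' y'. x \<in> carrier M \<Longrightarrow> y \<in> carrier N \<Longrightarrow> x' \<in> carrier M \<Longrightarrow> y' \<in> carrier N \<Longrightarrow>
        pure_tensor A M N x y \<otimes>\<^bsub>T\<^esub> pure_tensor A M N x' y' =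
        pure_tensor A M N (x \<otimes>\<^bsub>M\<^esub> x') (y \<otimes>\<^bsub>N\<^esub> y')"
proof -
  define T0 where "T0 = tensor_module A act M N"
  interpret T: tensor_product A M N T0
    unfolding T0_def by (rule tensor_product_tensor_module)
  have car: "carrier T = carrier T0" and add: "add T = add T0"
    unfolding T_def T0_def by (simp_all add: tensor_algebra_simps)
  have hom: "add_hom T T = add_hom T0 T0" by (simp add: add_hom_def car add)
  define B where "B x y = (\<lambda>x' y'. T.pure (x \<otimes>\<^bsub>M\<^esub> x') (y \<otimes>\<^bsub>N\<^esub> y'))" for x y
  have mult: "U \<otimes>\<^bsub>T\<^esub> V = tensor_lift T0 (\<lambda>x y. tensor_lift T0 (B x y) V) U" for U V
    by (simp add: T_def T0_def B_def tensor_algebra_def)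
  note pd = balancedD[OF T.pure_balanced]
  have B: "balanced A M N T0 (B x y)" if "x \<in> carrier M" "y \<in> carrier N" for x y
    unfolding B_def using that
    by (intro balancedI) (simp_all add: M_mult M_r_distr M_smult_r N_mult N_r_distr N_smult_r pd)
  note lB = T.tensor_lift_hom[OF T.T_abelian B]
  have C: "balanced A M N T0 (\<lambda>x y. tensor_lift T0 (B x y) V)" if V: "V \<in> carrier T0" for V
  proof (rule balancedI)
    fix x y assume "x \<in> carrier M" "y \<in> carrier N"
    then show "tensor_lift T0 (B x y) V \<in> carrier T0" by (rule add_hom_closed[OF lB V])
  next
    fix x x' y assume x: "x \<in> carrier M" "x' \<in> carrier M" "y \<in> carrier N"
    show "tensor_lift T0 (B (x \<oplus>\<^bsub>M\<^esub> x') y) V = tensor_lift T0 (B x y) V \<oplus>\<^bsub>T0\<^esub> tensor_lift T0 (B x' y) V"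
      by (rule T.tensor_lift_add[OF T.T_abelian B B _ B V])
        (simp_all add: x M_add, simp add: B_def x pd M_mult M_l_distr N_mult)
  next
    fix x y y' assume x: "x \<in> carrier M" "y \<in> carrier N" "y' \<in> carrier N"
    show "tensor_lift T0 (B x (y \<oplus>\<^bsub>N\<^esub> y')) V = tensor_lift T0 (B x y) V \<oplus>\<^bsub>T0\<^esub> tensor_lift T0 (B x y') V"
      by (rule T.tensor_lift_add[OF T.T_abelian B B _ B V])
        (simp_all add: x N_add, simp add: B_def x pd M_mult N_l_distr N_mult)
  next
    fix a x y assume x: "a \<in> carrier A" "x \<in> carrier M" "y \<in> carrier N"
    show "tensor_lift T0 (B (a \<odot>\<^bsub>M\<^esub> x) y) V = tensor_lift T0 (B x (a \<odot>\<^bsub>N\<^esub> y)) V"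
      by (rule T.tensor_lift_cong[OF T.T_abelian B B _ V])
        (simp_all add: x M_smult N_smult, simp add: B_def x pd M_smult_l N_smult_l M_mult N_mult)
  qed
  show "(\<lambda>U. U \<otimes>\<^bsub>T\<^esub> V) \<in> add_hom T T" if "V \<in> carrier T" for V
    unfolding hom mult using T.tensor_lift_hom[OF T.T_abelian C] that car by simp
  show "(\<lambda>V. U \<otimes>\<^bsub>T\<^esub> V) \<in> add_hom T T" if U: "U \<in> carrier T" for U
    unfolding hom mult
  proof (rule add_homI)
    fix V assume "V \<in> carrier T0"
    then show "tensor_lift T0 (\<lambda>x y. tensor_lift T0 (B x y) V) U \<in> carrier T0"
      using U car by (simp add: T.tensor_lift_closed[OF T.T_abelian C])
  next
    fix V V' assume V: "V \<in> carrier T0" "V' \<in> carrier T0"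
    show "tensor_lift T0 (\<lambda>x y. tensor_lift T0 (B x y) (V \<oplus>\<^bsub>T0\<^esub> V')) U =
      tensor_lift T0 (\<lambda>x y. tensor_lift T0 (B x y) V) U \<oplus>\<^bsub>T0\<^esub>
      tensor_lift T0 (\<lambda>x y. tensor_lift T0 (B x y) V') U"
      by (rule T.tensor_lift_add[OF T.T_abelian C C _ C])
        (use V U car in \<open>simp_all add: add_hom_add[OF lB]\<close>)
  qed
  show "T.pure x y \<otimes>\<^bsub>T\<^esub> T.pure x' y' = T.pure (x \<otimes>\<^bsub>M\<^esub> x') (y \<otimes>\<^bsub>N\<^esub> y')"
    if x: "x \<in> carrier M" "y \<in> carrier N" "x' \<in> carrier M" "y' \<in> carrier N" for x y x' y'
    unfolding mult using x
    by (simp add: T.tensor_lift_pure[OF T.T_abelian C] T.pure_closed T.tensor_lift_pure[OF T.T_abelian B])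
      (simp add: B_def)
qed

end

end

section \<open>Coassociativity and trilinear maps\<close>

lemma along_simps [simp]:
  "carrier (along f H) = carrier H"
  "x \<oplus>\<^bsub>along f H\<^esub> y = x \<oplus>\<^bsub>H\<^esub> y"
  "x \<otimes>\<^bsub>along f H\<^esub> y = x \<otimes>\<^bsub>H\<^esub> y"
  "a \<odot>\<^bsub>along f H\<^esub> x = f a \<otimes>\<^bsub>H\<^esub> x"
  by (simp_all add: along_def restrict_scalars_def regular_module_def)

context commutative_hopf_algebroid
begin

sublocale A: cring A using algebra_A by (rule algebra.M_cring)
sublocale H: cring H using algebra_H by (rule algebra.M_cring)

lemma s_ring_hom: "s \<in> ring_hom A H" and t_ring_hom: "t \<in> ring_hom A H"
  and \<epsilon>_ring_hom: "\<epsilon> \<in> ring_hom H A" and S_ring_hom: "S \<in> ring_hom H H"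
  and \<Delta>_ring_hom: "\<Delta> \<in> ring_hom H HH"
  using s_hom t_hom \<epsilon>_hom S_hom \<Delta>_hom by (simp_all add: algebra_hom_def)

lemmas s_simps [simp] = ring_hom_closed[OF s_ring_hom] ring_hom_mult[OF s_ring_hom]
  ring_hom_add[OF s_ring_hom] ring_hom_one[OF s_ring_hom]
lemmas t_simps [simp] = ring_hom_closed[OF t_ring_hom] ring_hom_mult[OF t_ring_hom]
  ring_hom_add[OF t_ring_hom] ring_hom_one[OF t_ring_hom]
lemmas \<epsilon>_simps [simp] = ring_hom_closed[OF \<epsilon>_ring_hom] ring_hom_mult[OF \<epsilon>_ring_hom]
  ring_hom_add[OF \<epsilon>_ring_hom] ring_hom_one[OF \<epsilon>_ring_hom]
lemmas S_simps [simp] = ring_hom_closed[OF S_ring_hom] ring_hom_mult[OF S_ring_hom]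
  ring_hom_add[OF S_ring_hom] ring_hom_one[OF S_ring_hom]
lemmas \<Delta>_closed [simp] = ring_hom_closed[OF \<Delta>_ring_hom]
lemmas \<Delta>_mult = ring_hom_mult[OF \<Delta>_ring_hom]
lemmas \<Delta>_add = ring_hom_add[OF \<Delta>_ring_hom]
lemmas \<Delta>_one = ring_hom_one[OF \<Delta>_ring_hom]

lemma \<Delta>_add_hom: "\<Delta> \<in> add_hom H HH"
  by (rule add_homI) (simp_all add: \<Delta>_add)

sublocale HH_factors: tensor_factors A "along t H" "along s H"
  by unfold_locales simp_all

sublocale HH: tensor_product A "along t H" "along s H" HH
  unfolding HH_def by (rule HH_factors.tensor_product_tensor_algebra)

lemma
  shows HH_mult_l: "\<And>V. V \<in> carrier HH \<Longrightarrow> (\<lambda>U. U \<otimes>\<^bsub>HH\<^esub> V) \<in> add_hom HH HH"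
    and HH_mult_r: "\<And>U. U \<in> carrier HH \<Longrightarrow> (\<lambda>V. U \<otimes>\<^bsub>HH\<^esub> V) \<in> add_hom HH HH"
    and HH_mult_pure: "\<And>x y x' y'. x \<in> carrier H \<Longrightarrow> y \<in> carrier H \<Longrightarrow> x' \<in> carrier H \<Longrightarrow> y' \<in> carrier H \<Longrightarrow>
        HH_pure x y \<otimes>\<^bsub>HH\<^esub> HH_pure x' y' = HH_pure (x \<otimes>\<^bsub>H\<^esub> x') (y \<otimes>\<^bsub>H\<^esub> y')"
  unfolding HH_pure_def
  using HH_factors.tensor_algebra_mult_l[OF _ _ _ _ _ _ _ _ _ _ HH_def]
    HH_factors.tensor_algebra_mult_r[OF _ _ _ _ _ _ _ _ _ _ HH_def]
    HH_factors.tensor_algebra_mult_pure[OF _ _ _ _ _ _ _ _ _ _ HH_def]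
  by (simp_all add: H.l_distr H.r_distr H.m_ac)

lemma HH_pure_closed [simp]: "u \<in> carrier H \<Longrightarrow> v \<in> carrier H \<Longrightarrow> HH_pure u v \<in> carrier HH"
  unfolding HH_pure_def using HH.pure_closed by simp

lemma HH_pure_balanced: "balanced A (along t H) (along s H) HH HH_pure"
  unfolding HH_pure_def by (rule HH.pure_balanced)

lemmas HH_pure_simps = balancedD(2-4)[OF HH_pure_balanced, simplified]

lemma HH_left_right_simps:
  "carrier HH_left = carrier HH" "x \<oplus>\<^bsub>HH_left\<^esub> y = x \<oplus>\<^bsub>HH\<^esub> y"
  "a \<odot>\<^bsub>HH_left\<^esub> X = HH_pure (s a) \<one>\<^bsub>H\<^esub> \<otimes>\<^bsub>HH\<^esub> X"
  "carrier HH_right = carrier HH" "x \<oplus>\<^bsub>HH_right\<^esub> y = x \<oplus>\<^bsub>HH\<^esub> y"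
  "a \<odot>\<^bsub>HH_right\<^esub> X = HH_pure \<one>\<^bsub>H\<^esub> (t a) \<otimes>\<^bsub>HH\<^esub> X"
  by (simp_all add: HH_left_def HH_right_def)

sublocale HH_H_factors: tensor_factors A HH_right "along s H"
  by unfold_locales
    (simp_all add: HH_left_right_simps add_hom_closed[OF HH_mult_r] HH.T.a_closed)

sublocale H_HH_factors: tensor_factors A "along t H" HH_left
  by unfold_locales
    (simp_all add: HH_left_right_simps add_hom_closed[OF HH_mult_r] HH.T.a_closed)

sublocale HH_H: tensor_product A HH_right "along s H" HH_H
  unfolding HH_H_def by (rule HH_H_factors.tensor_product_tensor_algebra)

sublocale H_HH: tensor_product A "along t H" HH_left H_HH
  unfolding H_HH_def by (rule H_HH_factors.tensor_product_tensor_algebra)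

text \<open>
  A map that is balanced in the first two variables for each third one, and in the last two for each
  first one.  These are the maps out of \<open>H \<otimes>\<^sub>A H \<otimes>\<^sub>A H\<close>, described without choosing a
  bracketing.
\<close>

definition trilinear :: "('p, 'r) ring_scheme \<Rightarrow> ('h \<Rightarrow> 'h \<Rightarrow> 'h \<Rightarrow> 'p) \<Rightarrow> bool" where
  "trilinear P \<phi> \<longleftrightarrow>
    (\<forall>w\<in>carrier H. balanced A (along t H) (along s H) P (\<lambda>u v. \<phi> u v w)) \<and>
    (\<forall>u\<in>carrier H. balanced A (along t H) (along s H) P (\<phi> u))"

text \<open>
  Coassociativity in Sweedler notation: \<open>\<phi> u\<^sub>1 u\<^sub>2 u\<^sub>3\<close> may be computed by splitting the first
  or the second leg of \<open>\<Delta> u\<close>.  The map \<open>\<phi>\<close> induces an additive map \<open>L\<close> on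
  \<open>H \<otimes>\<^sub>A (H \<otimes>\<^sub>A H)\<close>, and the claim is the image under \<open>L\<close> of the coassociativity
  axiom.  The work lies in verifying that each lift that occurs there is taken of a balanced map.
\<close>

lemma coassociative_trilinear:
  assumes P: "abelian_group P" and tri: "trilinear P \<phi>" and u: "u \<in> carrier H"
  shows "tensor_lift P (\<lambda>u1 u2. tensor_lift P (\<lambda>a b. \<phi> a b u2) (\<Delta> u1)) (\<Delta> u) =
    tensor_lift P (\<lambda>u1 u2. tensor_lift P (\<phi> u1) (\<Delta> u2)) (\<Delta> u)"
proof -
  have b0: "balanced A (along t H) (along s H) P (\<lambda>u v. \<phi> u v w)"
    and b1: "balanced A (along t H) (along s H) P (\<phi> w)" if "w \<in> carrier H" for w
    using tri that by (auto simp: trilinear_def)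
  note lh = HH.tensor_lift_hom[OF P b1]
  have lp: "tensor_lift P (\<phi> u) (HH_pure v w) = \<phi> u v w"
    if "u \<in> carrier H" "v \<in> carrier H" "w \<in> carrier H" for u v w
    unfolding HH_pure_def using that by (simp add: HH.tensor_lift_pure[OF P b1])
  have b2: "balanced A (along t H) HH_left P (\<lambda>u X. tensor_lift P (\<phi> u) X)"
  proof (rule balancedI; simp only: along_simps HH_left_right_simps)
    fix u X assume "u \<in> carrier H" "X \<in> carrier HH"
    then show "tensor_lift P (\<phi> u) X \<in> carrier P" by (rule add_hom_closed[OF lh])
  next
    fix u u' X assume u: "u \<in> carrier H" "u' \<in> carrier H" "X \<in> carrier HH"
    show "tensor_lift P (\<phi> (u \<oplus>\<^bsub>H\<^esub> u')) X = tensor_lift P (\<phi> u) X \<oplus>\<^bsub>P\<^esub> tensor_lift P (\<phi> u') X"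
      by (rule HH.tensor_lift_add[OF P b1 b1 _ b1 u(3)])
        (use u balancedD(2)[OF b0] in simp_all)
  next
    fix u X Y assume "u \<in> carrier H" "X \<in> carrier HH" "Y \<in> carrier HH"
    then show "tensor_lift P (\<phi> u) (X \<oplus>\<^bsub>HH\<^esub> Y) = tensor_lift P (\<phi> u) X \<oplus>\<^bsub>P\<^esub> tensor_lift P (\<phi> u) Y"
      by (rule add_hom_add[OF lh])
  next
    fix a u X assume a: "a \<in> carrier A" "u \<in> carrier H" "X \<in> carrier HH"
    then have ta: "t a \<otimes>\<^bsub>H\<^esub> u \<in> carrier H" by simp
    \<comment> \<open>Both sides are additive in \<open>X\<close>; on pure tensors this is balancedness of \<open>\<phi>\<close> in
      its first two variables.\<close>
    show "tensor_lift P (\<phi> (t a \<otimes>\<^bsub>H\<^esub> u)) X = tensor_lift P (\<phi> u) (HH_pure (s a) \<one>\<^bsub>H\<^esub> \<otimes>\<^bsub>HH\<^esub> X)"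
      by (rule HH.tensor_lift_eq[OF P b1[OF ta] add_hom_comp[OF HH_mult_r lh[OF a(2)]] _ a(3)])
        (use a balancedD(4)[OF b0, of _ a u] in \<open>simp_all add: HH_mult_pure lp flip: HH_pure_def\<close>)
  qed
  define L where "L = tensor_lift P (\<lambda>u X. tensor_lift P (\<phi> u) X)"
  have L: "L \<in> add_hom H_HH P"
    unfolding L_def by (rule H_HH.tensor_lift_hom[OF P b2])
  have L_pure: "L (H_HH_pure u X) = tensor_lift P (\<phi> u) X" if "u \<in> carrier H" "X \<in> carrier HH" for u X
    unfolding L_def H_HH_pure_def using that
    by (intro H_HH.tensor_lift_pure[OF P b2]) (simp_all add: HH_left_right_simps)
  note H_HH_d = balancedD[OF H_HH.pure_balanced, folded H_HH_pure_def, simplified along_simps HH_left_right_simps]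
  note HH_H_d = balancedD[OF HH_H.pure_balanced, folded HH_H_pure_def, simplified along_simps HH_left_right_simps]
  have b3: "balanced A (along t H) (along s H) H_HH (\<lambda>u1 u2. H_HH_pure u1 (\<Delta> u2))"
    by (rule balancedI) (simp_all add: H_HH_d \<Delta>_add \<Delta>_left HH_left_right_simps)
  have b4: "balanced A (along t H) (along s H) H_HH (\<lambda>u v. H_HH_pure u (HH_pure v w))"
    if "w \<in> carrier H" for w
    using that by (intro balancedI) (simp_all add: H_HH_d HH_pure_simps HH_mult_pure)
  \<comment> \<open>The inner part of the associativity map, \<open>u \<otimes> v, w \<mapsto> u \<otimes> (v \<otimes> w)\<close>.\<close>
  define as where "as = (\<lambda>U w. tensor_lift H_HH (\<lambda>u v. H_HH_pure u (HH_pure v w)) U)"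
  note as_hom = HH.tensor_lift_hom[OF H_HH.T_abelian b4]
  have b5: "balanced A HH_right (along s H) H_HH as"
    unfolding as_def
  proof (rule balancedI; simp only: along_simps HH_left_right_simps)
    fix X w assume "X \<in> carrier HH" "w \<in> carrier H"
    then show "tensor_lift H_HH (\<lambda>u v. H_HH_pure u (HH_pure v w)) X \<in> carrier H_HH"
      by (intro add_hom_closed[OF as_hom])
  next
    fix X Y w assume "X \<in> carrier HH" "Y \<in> carrier HH" "w \<in> carrier H"
    then show "tensor_lift H_HH (\<lambda>u v. H_HH_pure u (HH_pure v w)) (X \<oplus>\<^bsub>HH\<^esub> Y) =
      tensor_lift H_HH (\<lambda>u v. H_HH_pure u (HH_pure v w)) X \<oplus>\<^bsub>H_HH\<^esub>
      tensor_lift H_HH (\<lambda>u v. H_HH_pure u (HH_pure v w)) Y"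
      by (intro add_hom_add[OF as_hom])
  next
    fix X w w' assume w: "X \<in> carrier HH" "w \<in> carrier H" "w' \<in> carrier H"
    show "tensor_lift H_HH (\<lambda>u v. H_HH_pure u (HH_pure v (w \<oplus>\<^bsub>H\<^esub> w'))) X =
      tensor_lift H_HH (\<lambda>u v. H_HH_pure u (HH_pure v w)) X \<oplus>\<^bsub>H_HH\<^esub>
      tensor_lift H_HH (\<lambda>u v. H_HH_pure u (HH_pure v w')) X"
      by (rule HH.tensor_lift_add[OF H_HH.T_abelian b4 b4 _ b4 w(1)])
        (use w in \<open>simp_all add: HH_pure_simps H_HH_d\<close>)
  next
    fix a X w assume w: "a \<in> carrier A" "X \<in> carrier HH" "w \<in> carrier H"
    then have sw: "s a \<otimes>\<^bsub>H\<^esub> w \<in> carrier H" by simp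
    show "tensor_lift H_HH (\<lambda>u v. H_HH_pure u (HH_pure v w)) (HH_pure \<one>\<^bsub>H\<^esub> (t a) \<otimes>\<^bsub>HH\<^esub> X) =
      tensor_lift H_HH (\<lambda>u v. H_HH_pure u (HH_pure v (s a \<otimes>\<^bsub>H\<^esub> w))) X"
      by (rule HH.tensor_lift_eq[OF H_HH.T_abelian b4[OF sw] add_hom_comp[OF HH_mult_r as_hom[OF w(3)]] _ w(2), symmetric])
        (use w in \<open>simp_all add: HH_mult_pure HH.tensor_lift_pure[OF H_HH.T_abelian b4, folded HH_pure_def]
          HH_pure_simps flip: HH_pure_def\<close>)
  qed
  have assoc: "assoc_map \<in> add_hom HH_H H_HH"
    unfolding assoc_map_def as_def[symmetric] by (rule HH_H.tensor_lift_hom[OF H_HH.T_abelian b5])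
  have assoc_pure: "assoc_map (HH_H_pure U w) = as U w" if "U \<in> carrier HH" "w \<in> carrier H" for U w
    unfolding assoc_map_def as_def[symmetric] HH_H_pure_def using that
    by (intro HH_H.tensor_lift_pure[OF H_HH.T_abelian b5]) (simp_all add: HH_left_right_simps)
  have b6: "balanced A (along t H) (along s H) HH_H (\<lambda>u1 u2. HH_H_pure (\<Delta> u1) u2)"
    by (rule balancedI)
      (simp_all add: HH_H_d \<Delta>_add H.m_comm[of "t _"] \<Delta>_right HH_left_right_simps)
  have L_as: "L (as U w) = tensor_lift P (\<lambda>a b. \<phi> a b w) U" if "U \<in> carrier HH" "w \<in> carrier H" for U w
  proof -
    have "L (as U w) = tensor_lift P (\<lambda>a b. L (H_HH_pure a (HH_pure b w))) U"
      unfolding as_def by (rule HH.add_hom_tensor_lift[OF H_HH.T_abelian P b4 L]) (use that in simp_all)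
    also have "\<dots> = tensor_lift P (\<lambda>a b. \<phi> a b w) U"
      by (rule HH.tensor_lift_cong[OF P balanced_add_hom[OF b4 L] b0])
        (use that in \<open>simp_all add: L_pure lp\<close>)
    finally show ?thesis .
  qed
  have La: "(\<lambda>X. L (assoc_map X)) \<in> add_hom HH_H P" by (rule add_hom_comp[OF assoc L])
  note b6' = balanced_add_hom[OF b6 La] and b3' = balanced_add_hom[OF b3 L]
  have "tensor_lift P (\<lambda>u1 u2. tensor_lift P (\<lambda>a b. \<phi> a b u2) (\<Delta> u1)) (\<Delta> u) =
    tensor_lift P (\<lambda>u1 u2. L (assoc_map (HH_H_pure (\<Delta> u1) u2))) (\<Delta> u)"
  proof (rule HH.tensor_lift_cong[OF P _ b6'])
    show "balanced A (along t H) (along s H) P (\<lambda>u1 u2. tensor_lift P (\<lambda>a b. \<phi> a b u2) (\<Delta> u1))"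
      using b6' unfolding balanced_def by (simp add: assoc_pure L_as)
  qed (use u in \<open>simp_all add: assoc_pure L_as\<close>)
  also have "\<dots> = L (assoc_map (tensor_lift HH_H (\<lambda>u1 u2. HH_H_pure (\<Delta> u1) u2) (\<Delta> u)))"
    by (rule HH.add_hom_tensor_lift[OF HH_H.T_abelian P b6 La, symmetric]) (use u in simp)
  also have "\<dots> = L (tensor_lift H_HH (\<lambda>u1 u2. H_HH_pure u1 (\<Delta> u2)) (\<Delta> u))"
    using coassociative[OF u] by simp
  also have "\<dots> = tensor_lift P (\<lambda>u1 u2. L (H_HH_pure u1 (\<Delta> u2))) (\<Delta> u)"
    by (rule HH.add_hom_tensor_lift[OF H_HH.T_abelian P b3 L]) (use u in simp)
  also have "\<dots> = tensor_lift P (\<lambda>u1 u2. tensor_lift P (\<phi> u1) (\<Delta> u2)) (\<Delta> u)"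
  proof (rule HH.tensor_lift_cong[OF P b3'])
    show "balanced A (along t H) (along s H) P (\<lambda>u1 u2. tensor_lift P (\<phi> u1) (\<Delta> u2))"
      using b3' unfolding balanced_def by (simp add: L_pure)
  qed (use u in \<open>simp_all add: L_pure\<close>)
  finally show ?thesis .
qed

end

section \<open>The cotangent module\<close>

lemma (in cring) mult_minus_mult_expand:
  assumes "x \<in> carrier R" "y \<in> carrier R" "a \<in> carrier R" "b \<in> carrier R"
  shows "x \<otimes> y \<ominus> a \<otimes> b = ((x \<ominus> a) \<otimes> (y \<ominus> b) \<oplus> a \<otimes> (y \<ominus> b)) \<oplus> b \<otimes> (x \<ominus> a)"
  using assms by algebra

lemma (in cring) add_minus_add:
  assumes "x \<in> carrier R" "y \<in> carrier R" "a \<in> carrier R" "b \<in> carrier R"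
  shows "(x \<oplus> y) \<ominus> (a \<oplus> b) = (x \<ominus> a) \<oplus> (y \<ominus> b)"
  using assms by algebra

lemma (in cring) mult_minus_distr:
  assumes "x \<in> carrier R" "y \<in> carrier R" "a \<in> carrier R"
  shows "a \<otimes> x \<ominus> a \<otimes> y = a \<otimes> (x \<ominus> y)"
  using assms by algebra

lemma (in ideal) rcos_eq_imp_minus_mem:
  assumes "x \<in> carrier R" "y \<in> carrier R" "I +> x = I +> y"
  shows "x \<ominus> y \<in> I"
  using a_rcos_module_minus[OF ring_axioms assms(2,1)] a_rcos_self[OF assms(1)] assms(3) by simp

context commutative_hopf_algebroid
begin

lemma \<epsilon>_s [simp]: "a \<in> carrier A \<Longrightarrow> \<epsilon> (s a) = a"
  using \<epsilon>_left[of a "\<one>\<^bsub>H\<^esub>"] by simp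

lemma \<epsilon>_t [simp]: "a \<in> carrier A \<Longrightarrow> \<epsilon> (t a) = a"
  using \<epsilon>_right[of a "\<one>\<^bsub>H\<^esub>"] by simp

abbreviation "I \<equiv> aug_ideal A H \<epsilon>"
abbreviation "J \<equiv> I \<cdot>\<^bsub>H\<^esub> I"
abbreviation "I_mod_J \<equiv> cotangent_s A H s \<epsilon>"
abbreviation "\<pi> \<equiv> \<pi>\<^sub>s A H s \<epsilon>"
abbreviation "q u \<equiv> J +>\<^bsub>H\<^esub> u"

lemma mem_I_iff: "u \<in> I \<longleftrightarrow> u \<in> carrier H \<and> \<epsilon> u = \<zero>\<^bsub>A\<^esub>"
  by (simp add: aug_ideal_def a_kernel_def')

lemma I_ideal: "ideal I H"
  unfolding aug_ideal_def
  by (rule ring_hom_ring.kernel_is_ideal) (intro ring_hom_ringI2 H.ring_axioms A.ring_axioms \<epsilon>_ring_hom)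

sublocale J: ideal J H by (rule H.ideal_prod_is_ideal[OF I_ideal I_ideal])

lemma q_ring_hom: "q \<in> ring_hom H (H Quot J)"
  by (rule J.rcos_ring_hom)

lemma q_zero: "u \<in> J \<Longrightarrow> q u = q \<zero>\<^bsub>H\<^esub>"
  by (simp add: J.a_rcos_const)

lemma cotangent_simps:
  "carrier I_mod_J = q ` I"
  "X \<oplus>\<^bsub>I_mod_J\<^esub> Y = X \<oplus>\<^bsub>H Quot J\<^esub> Y"
  "a \<odot>\<^bsub>I_mod_J\<^esub> X = q (s a) \<otimes>\<^bsub>H Quot J\<^esub> X"
  by (simp_all add: cotangent_s_def restrict_scalars_def cotangent_module_def Let_def)

lemma q_add: "u \<in> carrier H \<Longrightarrow> v \<in> carrier H \<Longrightarrow> q u \<oplus>\<^bsub>I_mod_J\<^esub> q v = q (u \<oplus>\<^bsub>H\<^esub> v)"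
  unfolding cotangent_simps by (simp add: ring_hom_add[OF q_ring_hom])

lemma q_smult: "a \<in> carrier A \<Longrightarrow> u \<in> carrier H \<Longrightarrow> a \<odot>\<^bsub>I_mod_J\<^esub> q u = q (s a \<otimes>\<^bsub>H\<^esub> u)"
  unfolding cotangent_simps by (simp add: ring_hom_mult[OF q_ring_hom])

lemma minus_s\<epsilon>_mem_I: "u \<in> carrier H \<Longrightarrow> u \<ominus>\<^bsub>H\<^esub> s (\<epsilon> u) \<in> I"
proof -
  assume u: "u \<in> carrier H"
  interpret e: ring_hom_ring H A \<epsilon>
    by (intro ring_hom_ringI2 H.ring_axioms A.ring_axioms \<epsilon>_ring_hom)
  show ?thesis using u by (simp add: mem_I_iff a_minus_def e.hom_a_inv A.r_neg)
qed

lemma \<pi>_eq: "\<pi> u = q (u \<ominus>\<^bsub>H\<^esub> s (\<epsilon> u))"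
  by (simp add: \<pi>\<^sub>s_def)

lemma \<pi>_closed [simp]: "u \<in> carrier H \<Longrightarrow> \<pi> u \<in> carrier I_mod_J"
  unfolding \<pi>_eq cotangent_simps using minus_s\<epsilon>_mem_I by blast

lemma s_zero [simp]: "s \<zero>\<^bsub>A\<^esub> = \<zero>\<^bsub>H\<^esub>" and t_zero [simp]: "t \<zero>\<^bsub>A\<^esub> = \<zero>\<^bsub>H\<^esub>"
  using ring_hom_zero[OF s_ring_hom] ring_hom_zero[OF t_ring_hom] A.ring_axioms H.ring_axioms by auto

text \<open>
  On \<open>I\<close> the map \<open>\<pi>\<close> is just the projection, since \<open>\<epsilon>\<close> vanishes there.  Therefore
  every element of \<open>I/I\<^sup>2\<close> is some \<open>\<pi> u\<close>, and the arithmetic of \<open>I/I\<^sup>2\<close> can be done with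
  the rules for \<open>\<pi>\<close> only.
\<close>

lemma \<pi>_of_I: "u \<in> I \<Longrightarrow> \<pi> u = q u"
  by (simp add: \<pi>_eq mem_I_iff a_minus_def)

lemma carrier_cotangent: "carrier I_mod_J = \<pi> ` carrier H"
proof
  show "carrier I_mod_J \<subseteq> \<pi> ` carrier H"
  proof
    fix X assume "X \<in> carrier I_mod_J"
    then obtain u where u: "u \<in> I" "X = q u" unfolding cotangent_simps by (rule imageE)
    then have "X = \<pi> u" "u \<in> carrier H" by (simp_all add: \<pi>_of_I mem_I_iff)
    then show "X \<in> \<pi> ` carrier H" by (rule image_eqI)
  qed
  show "\<pi> ` carrier H \<subseteq> carrier I_mod_J" by (rule image_subsetI) simp
qed

lemma \<pi>_add: "u \<in> carrier H \<Longrightarrow> v \<in> carrier H \<Longrightarrow> \<pi> (u \<oplus>\<^bsub>H\<^esub> v) = \<pi> u \<oplus>\<^bsub>I_mod_J\<^esub> \<pi> v"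
  by (simp add: \<pi>_eq q_add H.add_minus_add)

lemma \<pi>_s_mult: "a \<in> carrier A \<Longrightarrow> u \<in> carrier H \<Longrightarrow> \<pi> (s a \<otimes>\<^bsub>H\<^esub> u) = a \<odot>\<^bsub>I_mod_J\<^esub> \<pi> u"
  by (simp add: \<pi>_eq q_smult H.mult_minus_distr)

text \<open>
  \<open>\<pi>\<close> is a derivation at the counit.  With \<open>u' = u - s(\<epsilon> u)\<close> and \<open>v' = v - s(\<epsilon> v)\<close> in
  \<open>I\<close>, the difference \<open>uv - s(\<epsilon>(uv))\<close> is \<open>u'v' + s(\<epsilon> u)v' + s(\<epsilon> v)u'\<close>, and
  \<open>u'v'\<close> lies in \<open>I\<^sup>2\<close>.
\<close>

lemma \<pi>_mult:
  assumes "u \<in> carrier H" "v \<in> carrier H"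
  shows "\<pi> (u \<otimes>\<^bsub>H\<^esub> v) = \<epsilon> u \<odot>\<^bsub>I_mod_J\<^esub> \<pi> v \<oplus>\<^bsub>I_mod_J\<^esub> \<epsilon> v \<odot>\<^bsub>I_mod_J\<^esub> \<pi> u"
proof -
  define u' v' where "u' = u \<ominus>\<^bsub>H\<^esub> s (\<epsilon> u)" and "v' = v \<ominus>\<^bsub>H\<^esub> s (\<epsilon> v)"
  have c: "u' \<in> carrier H" "v' \<in> carrier H" using assms by (auto simp: u'_def v'_def)
  have "u' \<in> I" "v' \<in> I" using assms by (auto simp: u'_def v'_def minus_s\<epsilon>_mem_I)
  then have "q (u' \<otimes>\<^bsub>H\<^esub> v') = q \<zero>\<^bsub>H\<^esub>" by (intro q_zero ideal_prod.prod)
  then have "q (u' \<otimes>\<^bsub>H\<^esub> v' \<oplus>\<^bsub>H\<^esub> s (\<epsilon> u) \<otimes>\<^bsub>H\<^esub> v') = q (s (\<epsilon> u) \<otimes>\<^bsub>H\<^esub> v')"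
    using assms c by (simp flip: q_add) (simp add: q_add)
  moreover have "\<pi> (u \<otimes>\<^bsub>H\<^esub> v) =
      q ((u' \<otimes>\<^bsub>H\<^esub> v' \<oplus>\<^bsub>H\<^esub> s (\<epsilon> u) \<otimes>\<^bsub>H\<^esub> v') \<oplus>\<^bsub>H\<^esub> s (\<epsilon> v) \<otimes>\<^bsub>H\<^esub> u')"
    using assms by (simp add: \<pi>_eq u'_def v'_def H.mult_minus_mult_expand)
  ultimately show ?thesis
    using assms c by (simp flip: q_add) (simp add: \<pi>_eq q_smult flip: u'_def v'_def)
qed

lemma \<pi>_eq_imp_minus_mem_J:
  assumes "u \<in> carrier H" "v \<in> carrier H" "\<pi> u = \<pi> v"
  shows "(u \<ominus>\<^bsub>H\<^esub> s (\<epsilon> u)) \<ominus>\<^bsub>H\<^esub> (v \<ominus>\<^bsub>H\<^esub> s (\<epsilon> v)) \<in> J"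
  using assms by (intro J.rcos_eq_imp_minus_mem) (simp_all add: \<pi>_eq)

section \<open>The derivation \<open>\<psi>\<close>\<close>

sublocale \<Omega>_factors: tensor_factors A "along t H" I_mod_J
proof
  fix x y assume "x \<in> carrier I_mod_J" "y \<in> carrier I_mod_J"
  then show "x \<oplus>\<^bsub>I_mod_J\<^esub> y \<in> carrier I_mod_J"
    unfolding carrier_cotangent by (auto simp flip: \<pi>_add)
next
  fix a x assume "a \<in> carrier A" "x \<in> carrier I_mod_J"
  then show "a \<odot>\<^bsub>I_mod_J\<^esub> x \<in> carrier I_mod_J"
    unfolding carrier_cotangent by (auto simp flip: \<pi>_s_mult)
qed simp_all

abbreviation "\<Omega> \<equiv> H_tensor_cotangent A H s t \<epsilon>"
abbreviation "\<psi> \<equiv> \<psi>\<^sub>s A H s t \<Delta> \<epsilon>"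

sublocale \<Omega>: tensor_product A "along t H" I_mod_J \<Omega>
  unfolding H_tensor_cotangent_def by (rule \<Omega>_factors.tensor_product_tensor_module)

lemma \<Omega>_module: "module H \<Omega>"
  unfolding H_tensor_cotangent_def
  by (rule \<Omega>_factors.tensor_module_is_module[OF H.is_cring]) (simp_all add: H.l_distr H.r_distr H.m_ac)

lemma \<Omega>_smult_pure:
  "r \<in> carrier H \<Longrightarrow> u \<in> carrier H \<Longrightarrow> n \<in> carrier I_mod_J \<Longrightarrow>
    r \<odot>\<^bsub>\<Omega>\<^esub> \<Omega>.pure u n = \<Omega>.pure (r \<otimes>\<^bsub>H\<^esub> u) n"
  unfolding H_tensor_cotangent_def
  by (rule \<Omega>_factors.tensor_module_smult_pure[OF H.is_cring]) (simp_all add: H.l_distr H.r_distr H.m_ac)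

lemmas \<Omega>_d = balancedD[OF \<Omega>.pure_balanced, simplified along_simps]

lemma HH_balancedI:
  assumes "\<And>u v. u \<in> carrier H \<Longrightarrow> v \<in> carrier H \<Longrightarrow> f u v \<in> carrier P"
    and "\<And>u u' v. u \<in> carrier H \<Longrightarrow> u' \<in> carrier H \<Longrightarrow> v \<in> carrier H \<Longrightarrow>
      f (u \<oplus>\<^bsub>H\<^esub> u') v = f u v \<oplus>\<^bsub>P\<^esub> f u' v"
    and "\<And>u v v'. u \<in> carrier H \<Longrightarrow> v \<in> carrier H \<Longrightarrow> v' \<in> carrier H \<Longrightarrow>
      f u (v \<oplus>\<^bsub>H\<^esub> v') = f u v \<oplus>\<^bsub>P\<^esub> f u v'"
    and "\<And>a u v. a \<in> carrier A \<Longrightarrow> u \<in> carrier H \<Longrightarrow> v \<in> carrier H \<Longrightarrow>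
      f (t a \<otimes>\<^bsub>H\<^esub> u) v = f u (s a \<otimes>\<^bsub>H\<^esub> v)"
  shows "balanced A (along t H) (along s H) P f"
  using assms by (intro balancedI) simp_all

abbreviation "bal P f \<equiv> balanced A (along t H) (along s H) P f"

lemma HH_lift_pure:
  assumes "abelian_group P" "bal P f" "u \<in> carrier H" "v \<in> carrier H"
  shows "tensor_lift P f (HH_pure u v) = f u v"
  unfolding HH_pure_def using assms by (intro HH.tensor_lift_pure) simp_all

lemma HH_add_hom_eq:
  assumes "abelian_group P" "h \<in> add_hom HH P" "k \<in> add_hom HH P"
    and "\<And>u v. u \<in> carrier H \<Longrightarrow> v \<in> carrier H \<Longrightarrow> h (HH_pure u v) = k (HH_pure u v)"
    and "X \<in> carrier HH"
  shows "h X = k X"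
  using assms(4) unfolding HH_pure_def
  by (intro HH.add_hom_eq_on_pure[OF assms(1-3) _ assms(5)]) simp

text \<open>
  A Leibniz rule on \<open>H \<otimes>\<^sub>A H\<close> follows from the same rule on pure tensors.  It is applied along
  \<open>\<Delta>\<close> twice: with \<open>R u v = u t(\<epsilon> v)\<close>, where the counit axiom turns the coefficients into
  \<open>u\<close> and \<open>v\<close>, to show that \<open>\<psi>\<close> is a derivation; and with \<open>R u v = S(u) v\<close>, where the
  antipode axiom turns them into \<open>t(\<epsilon> u)\<close> and \<open>t(\<epsilon> v)\<close>, for the map \<open>invariant_form\<close>.
\<close>

lemma leibniz_on_HH:
  assumes M: "module H M" and F: "bal M F" and R: "bal H R"
    and FR: "\<And>u v u' v'. u \<in> carrier H \<Longrightarrow> v \<in> carrier H \<Longrightarrow> u' \<in> carrier H \<Longrightarrow> v' \<in> carrier H \<Longrightarrow>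
      F (u \<otimes>\<^bsub>H\<^esub> u') (v \<otimes>\<^bsub>H\<^esub> v') = R u v \<odot>\<^bsub>M\<^esub> F u' v' \<oplus>\<^bsub>M\<^esub> R u' v' \<odot>\<^bsub>M\<^esub> F u v"
    and X: "X \<in> carrier HH" and Y: "Y \<in> carrier HH"
  shows "tensor_lift M F (X \<otimes>\<^bsub>HH\<^esub> Y) =
    tensor_lift H R X \<odot>\<^bsub>M\<^esub> tensor_lift M F Y \<oplus>\<^bsub>M\<^esub> tensor_lift H R Y \<odot>\<^bsub>M\<^esub> tensor_lift M F X"
proof -
  interpret M: module H M by fact
  note Mab = M.abelian_group_axioms and Hab = H.abelian_group_axioms
  note LF = HH.tensor_lift_hom[OF Mab F] and LR = HH.tensor_lift_hom[OF Hab R]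
  note lp = HH_lift_pure[OF Mab F] HH_lift_pure[OF Hab R]
  note [simp] = add_hom_closed[OF LF] add_hom_closed[OF LR] balancedD(1)[OF F, simplified along_simps]
    balancedD(1)[OF R, simplified along_simps]
  have sl: "(\<lambda>X. tensor_lift H R X \<odot>\<^bsub>M\<^esub> m) \<in> add_hom HH M" if "m \<in> carrier M" for m
    using that by (intro add_homI) (simp_all add: add_hom_add[OF LR] M.smult_l_distr)
  have sr: "(\<lambda>X. r \<odot>\<^bsub>M\<^esub> tensor_lift M F X) \<in> add_hom HH M" if "r \<in> carrier H" for r
    using that by (intro add_homI) (simp_all add: add_hom_add[OF LF] M.smult_r_distr)
  \<comment> \<open>First the left factor is taken to be a pure tensor, then the right factor is arbitrary.\<close>
  have *: "tensor_lift M F (HH_pure u v \<otimes>\<^bsub>HH\<^esub> Y) =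
      R u v \<odot>\<^bsub>M\<^esub> tensor_lift M F Y \<oplus>\<^bsub>M\<^esub> tensor_lift H R Y \<odot>\<^bsub>M\<^esub> F u v"
    if uv: "u \<in> carrier H" "v \<in> carrier H" for u v
    by (rule HH_add_hom_eq[OF Mab add_hom_comp[OF HH_mult_r LF] add_hom_pointwise_add[OF Mab sr sl] _ Y])
      (use uv in \<open>simp_all add: HH_mult_pure lp FR\<close>)
  show ?thesis
    by (rule HH_add_hom_eq[OF Mab add_hom_comp[OF HH_mult_l LF] add_hom_pointwise_add[OF Mab sl sr] _ X])
      (use Y in \<open>simp_all add: * lp\<close>)
qed

lemma \<psi>_balanced: "bal \<Omega> (\<lambda>u v. \<Omega>.pure u (\<pi> v))"
  by (rule HH_balancedI) (simp_all add: \<Omega>_d \<pi>_add \<pi>_s_mult)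

lemma \<psi>_apply: "u \<in> carrier H \<Longrightarrow> \<psi> u = tensor_lift \<Omega> (\<lambda>u v. \<Omega>.pure u (\<pi> v)) (\<Delta> u)"
  by (simp add: \<psi>\<^sub>s_def)

lemma \<psi>_closed: "u \<in> carrier H \<Longrightarrow> \<psi> u \<in> carrier \<Omega>"
  by (simp add: \<psi>_apply HH.tensor_lift_closed[OF \<Omega>.T_abelian \<psi>_balanced])

lemma \<Delta>_s: "a \<in> carrier A \<Longrightarrow> \<Delta> (s a) = HH_pure (s a) \<one>\<^bsub>H\<^esub>"
proof -
  assume a: "a \<in> carrier A"
  have one: "\<Delta> \<one>\<^bsub>H\<^esub> = HH_pure \<one>\<^bsub>H\<^esub> \<one>\<^bsub>H\<^esub>"
    unfolding \<Delta>_one HH_pure_def by (simp add: HH_def tensor_algebra_def) (simp add: along_def restrict_scalars_def regular_module_def)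
  show ?thesis
    using \<Delta>_left[OF a H.one_closed] a by (simp add: one HH_left_right_simps HH_mult_pure)
qed

text \<open>
  Linearity over the base field is automatic: the scalar \<open>c\<close> acts on \<open>H\<close> as multiplication by
  \<open>s(c 1)\<close>, which a derivation vanishing on the image of \<open>s\<close> treats as a constant.
\<close>

lemma Der_sI:
  assumes M: "module H M" and ext: "\<delta> \<in> extensional (carrier H)"
    and closed: "\<And>u. u \<in> carrier H \<Longrightarrow> \<delta> u \<in> carrier M"
    and add: "\<And>u v. u \<in> carrier H \<Longrightarrow> v \<in> carrier H \<Longrightarrow> \<delta> (u \<oplus>\<^bsub>H\<^esub> v) = \<delta> u \<oplus>\<^bsub>M\<^esub> \<delta> v"
    and mult: "\<And>u v. u \<in> carrier H \<Longrightarrow> v \<in> carrier H \<Longrightarrow>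
      \<delta> (u \<otimes>\<^bsub>H\<^esub> v) = u \<odot>\<^bsub>M\<^esub> \<delta> v \<oplus>\<^bsub>M\<^esub> v \<odot>\<^bsub>M\<^esub> \<delta> u"
    and s: "\<And>a. a \<in> carrier A \<Longrightarrow> \<delta> (s a) = \<zero>\<^bsub>M\<^esub>"
  shows "\<delta> \<in> Der_s K A H s M"
proof -
  interpret M: module H M by fact
  interpret KA: algebra K A by (rule algebra_A)
  interpret KH: algebra K H by (rule algebra_H)
  have "\<delta> (c \<odot>\<^bsub>H\<^esub> u) = (c \<odot>\<^bsub>H\<^esub> \<one>\<^bsub>H\<^esub>) \<odot>\<^bsub>M\<^esub> \<delta> u" if c: "c \<in> carrier K" and u: "u \<in> carrier H" for c u
  proof -
    have c1: "c \<odot>\<^bsub>H\<^esub> \<one>\<^bsub>H\<^esub> = s (c \<odot>\<^bsub>A\<^esub> \<one>\<^bsub>A\<^esub>)" "c \<odot>\<^bsub>A\<^esub> \<one>\<^bsub>A\<^esub> \<in> carrier A"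
      using s_hom c by (auto simp: algebra_hom_def)
    have "c \<odot>\<^bsub>H\<^esub> u = s (c \<odot>\<^bsub>A\<^esub> \<one>\<^bsub>A\<^esub>) \<otimes>\<^bsub>H\<^esub> u"
      using KH.smult_assoc2[of c "\<one>\<^bsub>H\<^esub>" u] c u by (simp add: c1)
    then show ?thesis using c1 u by (simp add: mult s closed)
  qed
  then show ?thesis using assms by (simp add: Der_s_def PiE_def)
qed

lemma counit_right_balanced: "bal H (\<lambda>u v. u \<otimes>\<^bsub>H\<^esub> t (\<epsilon> v))"
  by (rule HH_balancedI) (simp_all add: H.l_distr H.r_distr H.m_ac)

lemma pure_zero: assumes "u \<in> carrier H" shows "\<Omega>.pure u (q \<zero>\<^bsub>H\<^esub>) = \<zero>\<^bsub>\<Omega>\<^esub>"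
proof -
  have "\<zero>\<^bsub>H\<^esub> \<in> I"
    using additive_subgroup.zero_closed[OF ideal.axioms(1)[OF I_ideal]] .
  then have "q \<zero>\<^bsub>H\<^esub> \<in> carrier I_mod_J" by (simp add: cotangent_simps)
  then show ?thesis
    using \<Omega>_d(3)[of u "q \<zero>\<^bsub>H\<^esub>" "q \<zero>\<^bsub>H\<^esub>"] \<Omega>_d(1)[of u "q \<zero>\<^bsub>H\<^esub>"] assms by (simp add: q_add)
qed

lemma \<psi>_Der: "\<psi> \<in> Der_s K A H s \<Omega>"
proof (rule Der_sI[OF \<Omega>_module])
  interpret O: module H \<Omega> by (rule \<Omega>_module)
  show "\<psi> \<in> extensional (carrier H)" by (simp add: \<psi>\<^sub>s_def)
  fix u v assume u: "u \<in> carrier H" and v: "v \<in> carrier H"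
  note L = HH.tensor_lift_hom[OF \<Omega>.T_abelian \<psi>_balanced]
  show "\<psi> (u \<oplus>\<^bsub>H\<^esub> v) = \<psi> u \<oplus>\<^bsub>\<Omega>\<^esub> \<psi> v"
    using u v by (simp add: \<psi>_apply \<Delta>_add add_hom_add[OF L])
  have "tensor_lift \<Omega> (\<lambda>u v. \<Omega>.pure u (\<pi> v)) (\<Delta> u \<otimes>\<^bsub>HH\<^esub> \<Delta> v) =
    tensor_lift H (\<lambda>u v. u \<otimes>\<^bsub>H\<^esub> t (\<epsilon> v)) (\<Delta> u) \<odot>\<^bsub>\<Omega>\<^esub> tensor_lift \<Omega> (\<lambda>u v. \<Omega>.pure u (\<pi> v)) (\<Delta> v) \<oplus>\<^bsub>\<Omega>\<^esub>
    tensor_lift H (\<lambda>u v. u \<otimes>\<^bsub>H\<^esub> t (\<epsilon> v)) (\<Delta> v) \<odot>\<^bsub>\<Omega>\<^esub> tensor_lift \<Omega> (\<lambda>u v. \<Omega>.pure u (\<pi> v)) (\<Delta> u)"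
  proof (rule leibniz_on_HH[OF \<Omega>_module \<psi>_balanced counit_right_balanced])
    fix u v u' v' assume c: "u \<in> carrier H" "v \<in> carrier H" "u' \<in> carrier H" "v' \<in> carrier H"
    have n: "\<epsilon> v \<odot>\<^bsub>I_mod_J\<^esub> \<pi> v' \<in> carrier I_mod_J" "\<epsilon> v' \<odot>\<^bsub>I_mod_J\<^esub> \<pi> v \<in> carrier I_mod_J"
      using c by (simp_all add: \<Omega>_factors.N_smult)
    show "\<Omega>.pure (u \<otimes>\<^bsub>H\<^esub> u') (\<pi> (v \<otimes>\<^bsub>H\<^esub> v')) =
      (u \<otimes>\<^bsub>H\<^esub> t (\<epsilon> v)) \<odot>\<^bsub>\<Omega>\<^esub> \<Omega>.pure u' (\<pi> v') \<oplus>\<^bsub>\<Omega>\<^esub> (u' \<otimes>\<^bsub>H\<^esub> t (\<epsilon> v')) \<odot>\<^bsub>\<Omega>\<^esub> \<Omega>.pure u (\<pi> v)"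
      using c n by (simp add: \<pi>_mult \<Omega>_smult_pure \<Omega>_d(3) flip: \<Omega>_d(4)) (simp add: H.m_ac)
  qed (use u v in simp_all)
  then show "\<psi> (u \<otimes>\<^bsub>H\<^esub> v) = u \<odot>\<^bsub>\<Omega>\<^esub> \<psi> v \<oplus>\<^bsub>\<Omega>\<^esub> v \<odot>\<^bsub>\<Omega>\<^esub> \<psi> u"
    using u v by (simp add: \<psi>_apply \<Delta>_mult counit_right)
next
  fix a assume a: "a \<in> carrier A"
  have "\<pi> \<one>\<^bsub>H\<^esub> = q \<zero>\<^bsub>H\<^esub>" by (simp add: \<pi>_eq a_minus_def H.r_neg)
  then show "\<psi> (s a) = \<zero>\<^bsub>\<Omega>\<^esub>"
    using a by (simp add: \<psi>_apply \<Delta>_s HH_lift_pure[OF \<Omega>.T_abelian \<psi>_balanced] pure_zero)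
qed (rule \<psi>_closed)

end

section \<open>Derivations and representing pairs\<close>

lemma Der_sD:
  assumes "\<delta> \<in> Der_s K A H s M"
  shows "u \<in> carrier H \<Longrightarrow> \<delta> u \<in> carrier M"
    and "u \<in> carrier H \<Longrightarrow> v \<in> carrier H \<Longrightarrow> \<delta> (u \<oplus>\<^bsub>H\<^esub> v) = \<delta> u \<oplus>\<^bsub>M\<^esub> \<delta> v"
    and "u \<in> carrier H \<Longrightarrow> v \<in> carrier H \<Longrightarrow>
      \<delta> (u \<otimes>\<^bsub>H\<^esub> v) = u \<odot>\<^bsub>M\<^esub> \<delta> v \<oplus>\<^bsub>M\<^esub> v \<odot>\<^bsub>M\<^esub> \<delta> u"
    and "a \<in> carrier A \<Longrightarrow> \<delta> (s a) = \<zero>\<^bsub>M\<^esub>"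
    and "\<delta> \<in> extensional (carrier H)"
  using assms by (auto simp: Der_s_def PiE_iff)

lemma module_homD:
  assumes "f \<in> module_hom R M N"
  shows "x \<in> carrier M \<Longrightarrow> f x \<in> carrier N"
    and "x \<in> carrier M \<Longrightarrow> y \<in> carrier M \<Longrightarrow> f (x \<oplus>\<^bsub>M\<^esub> y) = f x \<oplus>\<^bsub>N\<^esub> f y"
    and "r \<in> carrier R \<Longrightarrow> x \<in> carrier M \<Longrightarrow> f (r \<odot>\<^bsub>M\<^esub> x) = r \<odot>\<^bsub>N\<^esub> f x"
    and "f \<in> extensional (carrier M)"
  using assms by (auto simp: module_hom_def PiE_iff)

lemma module_hom_add_hom: "f \<in> module_hom R M N \<Longrightarrow> f \<in> add_hom M N"
  by (auto simp: module_hom_def add_hom_def PiE_iff)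

lemma module_hom_restrictI:
  assumes "abelian_group M" "f \<in> add_hom M N"
    and "\<And>r x. r \<in> carrier R \<Longrightarrow> x \<in> carrier M \<Longrightarrow> r \<odot>\<^bsub>M\<^esub> x \<in> carrier M"
    and "\<And>r x. r \<in> carrier R \<Longrightarrow> x \<in> carrier M \<Longrightarrow> f (r \<odot>\<^bsub>M\<^esub> x) = r \<odot>\<^bsub>N\<^esub> f x"
  shows "restrict f (carrier M) \<in> module_hom R M N"
proof -
  interpret M: abelian_group M by fact
  show ?thesis using assms(2-) by (auto simp: module_hom_def add_hom_def)
qed

lemma module_hom_compose:
  assumes "f \<in> module_hom R L M" "g \<in> module_hom R M N" "module R L"
  shows "compose (carrier L) g f \<in> module_hom R L N"
proof -
  interpret L: module R L by fact
  show ?thesis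
    by (auto simp: module_hom_def compose_def module_homD[OF assms(1)] module_homD[OF assms(2)])
qed

text \<open>
  The usual argument for objects with a universal property.  It needs each of the two pairs to
  represent derivations into both modules: the mixed cases give the maps in the two directions, the
  others show that their composites are identities.
\<close>

lemma representing_unique_iso:
  fixes W :: "('h, 'w) module" and V :: "('h, 'v) module"
  assumes W: "module H W" and V: "module H V"
    and d: "d \<in> Der_s K A H s W" and e: "e \<in> Der_s K A H s V"
    and WW: "represents_Der_s K A H s W d W" and WV: "represents_Der_s K A H s W d V"
    and VW: "represents_Der_s K A H s V e W" and VV: "represents_Der_s K A H s V e V"
  shows "\<exists>!\<phi>. \<phi> \<in> module_iso H W V \<and> (\<forall>u\<in>carrier H. \<phi> (d u) = e u)"
proof -
  interpret W: module H W by fact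
  interpret V: module H V by fact
  have ex: "\<exists>f\<in>module_hom H X Y. \<forall>u\<in>carrier H. f (c u) = c' u"
    if "represents_Der_s K A H s X c Y" "c' \<in> Der_s K A H s Y"
    for X :: "('h, 'x) module" and Y :: "('h, 'y) module" and c c'
  proof -
    have "c' \<in> (\<lambda>f. compose (carrier H) f c) ` module_hom H X Y"
      using that by (simp add: represents_Der_s_def bij_betw_def)
    then obtain f where "f \<in> module_hom H X Y" "c' = compose (carrier H) f c" by blast
    then show ?thesis by (intro bexI[of _ f]) (simp_all add: compose_eq)
  qed
  have inj: "f = g"
    if "represents_Der_s K A H s X c Y" "f \<in> module_hom H X Y" "g \<in> module_hom H X Y"
      "\<And>u. u \<in> carrier H \<Longrightarrow> f (c u) = g (c u)"
    for X :: "('h, 'x) module" and Y :: "('h, 'y) module" and c f g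
  proof -
    have "compose (carrier H) f c = compose (carrier H) g c"
      using that(4) by (auto simp: compose_def restrict_def)
    then show ?thesis
      using that(1-3) by (auto simp: represents_Der_s_def bij_betw_def dest: inj_onD)
  qed
  obtain f where f: "f \<in> module_hom H W V" "\<And>u. u \<in> carrier H \<Longrightarrow> f (d u) = e u"
    using ex[OF WV e] by blast
  obtain g where g: "g \<in> module_hom H V W" "\<And>u. u \<in> carrier H \<Longrightarrow> g (e u) = d u"
    using ex[OF VW d] by blast
  have idW: "restrict (\<lambda>x. x) (carrier W) \<in> module_hom H W W"
    and idV: "restrict (\<lambda>x. x) (carrier V) \<in> module_hom H V V"
    by (auto simp: module_hom_def)
  have "compose (carrier W) g f = restrict (\<lambda>x. x) (carrier W)"
    by (rule inj[OF WW module_hom_compose[OF f(1) g(1) W] idW])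
      (simp add: compose_eq Der_sD(1)[OF d] f(2) g(2))
  then have gf: "g (f x) = x" if "x \<in> carrier W" for x
    using that by (metis compose_eq restrict_apply')
  have "compose (carrier V) f g = restrict (\<lambda>x. x) (carrier V)"
    by (rule inj[OF VV module_hom_compose[OF g(1) f(1) V] idV])
      (simp add: compose_eq Der_sD(1)[OF e] f(2) g(2))
  then have fg: "f (g x) = x" if "x \<in> carrier V" for x
    using that by (metis compose_eq restrict_apply')
  have "bij_betw f (carrier W) (carrier V)"
    by (rule bij_betw_byWitness[of _ g]) (auto simp: gf fg module_homD(1)[OF f(1)] module_homD(1)[OF g(1)])
  then have "f \<in> module_iso H W V" using f(1) by (simp add: module_iso_def)
  moreover have "f' = f" if "f' \<in> module_iso H W V" "\<forall>u\<in>carrier H. f' (d u) = e u" for f'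
    by (rule inj[OF WV]) (use that f in \<open>auto simp: module_iso_def\<close>)
  ultimately show ?thesis using f(2) by blast
qed

section \<open>The universal property of \<open>\<psi>\<close>\<close>

context commutative_hopf_algebroid
begin

lemma compose_Der_s:
  assumes M: "module H M" and W: "module H W" and d: "d \<in> Der_s K A H s W" and f: "f \<in> module_hom H W M"
  shows "compose (carrier H) f d \<in> Der_s K A H s M"
proof -
  interpret M: module H M by fact
  interpret W: module H W by fact
  have f0: "f \<zero>\<^bsub>W\<^esub> = \<zero>\<^bsub>M\<^esub>"
    by (rule add_hom_zero[OF W.abelian_group_axioms M.abelian_group_axioms module_hom_add_hom[OF f]])
  show ?thesis
    by (rule Der_sI[OF M])
      (simp_all add: compose_eq Der_sD(1-4)[OF d] module_homD[OF f] f0)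
qed

text \<open>
  Equality on carriers suffices for the bijection, because module maps and derivations are both
  taken extensional.
\<close>

lemma represents_Der_sI:
  assumes M: "module H M" and W: "module H W" and d: "d \<in> Der_s K A H s W"
    and unique: "\<And>f g x. f \<in> module_hom H W M \<Longrightarrow> g \<in> module_hom H W M \<Longrightarrow>
      (\<And>u. u \<in> carrier H \<Longrightarrow> f (d u) = g (d u)) \<Longrightarrow> x \<in> carrier W \<Longrightarrow> f x = g x"
    and ex: "\<And>\<delta>. \<delta> \<in> Der_s K A H s M \<Longrightarrow> \<exists>f\<in>module_hom H W M. \<forall>u\<in>carrier H. f (d u) = \<delta> u"
  shows "represents_Der_s K A H s W d M"
  unfolding represents_Der_s_def bij_betw_def
proof
  show "inj_on (\<lambda>f. compose (carrier H) f d) (module_hom H W M)"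
  proof (rule inj_onI)
    fix f g assume fg: "f \<in> module_hom H W M" "g \<in> module_hom H W M"
      and eq: "compose (carrier H) f d = compose (carrier H) g d"
    have "f (d u) = g (d u)" if "u \<in> carrier H" for u
      using fun_cong[OF eq, of u] that by (simp add: compose_eq)
    then show "f = g"
      using unique[OF fg] module_homD(4)[OF fg(1)] module_homD(4)[OF fg(2)]
      by (intro extensionalityI[of f "carrier W" g]) auto
  qed
  show "(\<lambda>f. compose (carrier H) f d) ` module_hom H W M = Der_s K A H s M"
  proof (intro equalityI subsetI)
    fix \<delta> assume "\<delta> \<in> (\<lambda>f. compose (carrier H) f d) ` module_hom H W M"
    then show "\<delta> \<in> Der_s K A H s M" using compose_Der_s[OF M W d] by blast
  next
    fix \<delta> assume \<delta>: "\<delta> \<in> Der_s K A H s M"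
    then obtain f where f: "f \<in> module_hom H W M" "\<And>u. u \<in> carrier H \<Longrightarrow> f (d u) = \<delta> u" using ex by blast
    have "\<delta> = compose (carrier H) f d"
      using f(2) Der_sD(5)[OF \<delta>] by (intro extensionalityI[of _ "carrier H"]) (auto simp: compose_def)
    then show "\<delta> \<in> (\<lambda>f. compose (carrier H) f d) ` module_hom H W M" using f(1) by blast
  qed
qed

lemma antipode_left_balanced: "bal H (\<lambda>u v. S u \<otimes>\<^bsub>H\<^esub> v)"
  by (rule HH_balancedI) (simp_all add: H.l_distr H.r_distr S_t H.m_ac)

lemma antipode_right_balanced: "bal H (\<lambda>u v. u \<otimes>\<^bsub>H\<^esub> S v)"
  by (rule HH_balancedI) (simp_all add: H.l_distr H.r_distr S_s H.m_ac)

lemma counit_left_balanced: "bal H (\<lambda>u v. s (\<epsilon> u) \<otimes>\<^bsub>H\<^esub> v)"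
  by (rule HH_balancedI) (simp_all add: H.l_distr H.r_distr H.m_ac)

lemma \<pi>_mult_s: "a \<in> carrier A \<Longrightarrow> u \<in> carrier H \<Longrightarrow> \<pi> (u \<otimes>\<^bsub>H\<^esub> s a) = a \<odot>\<^bsub>I_mod_J\<^esub> \<pi> u"
  by (simp add: H.m_comm[of u] \<pi>_s_mult)

text \<open>
  In Sweedler notation, \<open>S(v\<^sub>1) \<psi>(v\<^sub>2) = S(v\<^sub>1) v\<^sub>2 \<otimes> \<pi>(v\<^sub>3) = t(\<epsilon> v\<^sub>1) \<otimes> \<pi>(v\<^sub>2) =
  1 \<otimes> \<pi>(s(\<epsilon> v\<^sub>1) v\<^sub>2) = 1 \<otimes> \<pi>(v)\<close>.  Hence the image of \<open>\<psi>\<close> generates the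
  \<open>H\<close>-module \<open>\<Omega>\<close>, which gives uniqueness of factorizations through \<open>\<psi>\<close>.
\<close>

lemma pure_eq_antipode_\<psi>:
  assumes v: "v \<in> carrier H"
  shows "\<Omega>.pure \<one>\<^bsub>H\<^esub> (\<pi> v) = tensor_lift \<Omega> (\<lambda>v1 v2. S v1 \<odot>\<^bsub>\<Omega>\<^esub> \<psi> v2) (\<Delta> v)"
proof -
  interpret O: module H \<Omega> by (rule \<Omega>_module)
  note ab = \<Omega>.T_abelian and Hab = H.abelian_group_axioms
  define \<phi> where "\<phi> = (\<lambda>a b c. \<Omega>.pure (S a \<otimes>\<^bsub>H\<^esub> b) (\<pi> c))"
  have tri: "trilinear \<Omega> \<phi>"
    unfolding trilinear_def \<phi>_def
    by (intro conjI ballI HH_balancedI)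
      (simp_all add: \<Omega>_d(1-3) \<pi>_add \<pi>_s_mult \<pi>_mult_s H.l_distr H.r_distr S_t H.m_ac flip: \<Omega>_d(4))
  have right: "tensor_lift \<Omega> (\<phi> a) (\<Delta> u) = S a \<odot>\<^bsub>\<Omega>\<^esub> \<psi> u" if a: "a \<in> carrier H" and u: "u \<in> carrier H" for a u
  proof -
    have "(\<lambda>x. S a \<odot>\<^bsub>\<Omega>\<^esub> x) \<in> add_hom \<Omega> \<Omega>"
      using a by (intro add_homI) (simp_all add: O.smult_r_distr)
    from HH.add_hom_tensor_lift[OF ab ab \<psi>_balanced this \<Delta>_closed[OF u]]
    have "S a \<odot>\<^bsub>\<Omega>\<^esub> \<psi> u = tensor_lift \<Omega> (\<lambda>x y. S a \<odot>\<^bsub>\<Omega>\<^esub> \<Omega>.pure x (\<pi> y)) (\<Delta> u)"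
      using u by (simp add: \<psi>_apply)
    also have "\<dots> = tensor_lift \<Omega> (\<phi> a) (\<Delta> u)"
      using tri a u
      by (intro HH.tensor_lift_cong[OF ab balanced_add_hom[OF \<psi>_balanced \<open>(\<lambda>x. S a \<odot>\<^bsub>\<Omega>\<^esub> x) \<in> add_hom \<Omega> \<Omega>\<close>]])
        (auto simp: trilinear_def \<phi>_def \<Omega>_smult_pure)
    finally show ?thesis by simp
  qed
  have left: "tensor_lift \<Omega> (\<lambda>a b. \<phi> a b w) (\<Delta> u) = \<Omega>.pure \<one>\<^bsub>H\<^esub> (\<pi> (s (\<epsilon> u) \<otimes>\<^bsub>H\<^esub> w))"
    if u: "u \<in> carrier H" and w: "w \<in> carrier H" for u w
  proof -
    have h: "(\<lambda>x. \<Omega>.pure x (\<pi> w)) \<in> add_hom H \<Omega>"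
      using w by (intro add_homI) (simp_all add: \<Omega>_d)
    show ?thesis
      using HH.add_hom_tensor_lift[OF Hab ab antipode_left_balanced h \<Delta>_closed[OF u]] u w
      by (simp add: \<phi>_def antipode_left \<pi>_s_mult \<Omega>_d(4)[symmetric])
  qed
  have h: "(\<lambda>x. \<Omega>.pure \<one>\<^bsub>H\<^esub> (\<pi> x)) \<in> add_hom H \<Omega>"
    by (intro add_homI) (simp_all add: \<Omega>_d \<pi>_add)
  have "\<Omega>.pure \<one>\<^bsub>H\<^esub> (\<pi> v) = tensor_lift \<Omega> (\<lambda>a b. \<Omega>.pure \<one>\<^bsub>H\<^esub> (\<pi> (s (\<epsilon> a) \<otimes>\<^bsub>H\<^esub> b))) (\<Delta> v)"
    using HH.add_hom_tensor_lift[OF Hab ab counit_left_balanced h \<Delta>_closed[OF v]] v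
    by (simp add: counit_left)
  also have "\<dots> = tensor_lift \<Omega> (\<lambda>u1 u2. tensor_lift \<Omega> (\<lambda>a b. \<phi> a b u2) (\<Delta> u1)) (\<Delta> v)"
  proof (rule HH.tensor_lift_cong[OF ab balanced_add_hom[OF counit_left_balanced h]])
    show "bal \<Omega> (\<lambda>u1 u2. tensor_lift \<Omega> (\<lambda>a b. \<phi> a b u2) (\<Delta> u1))"
      using balanced_add_hom[OF counit_left_balanced h] unfolding balanced_def by (simp add: left)
  qed (use v in \<open>simp_all add: left\<close>)
  also have "\<dots> = tensor_lift \<Omega> (\<lambda>u1 u2. tensor_lift \<Omega> (\<phi> u1) (\<Delta> u2)) (\<Delta> v)"
    by (rule coassociative_trilinear[OF ab tri v])
  also have "\<dots> = tensor_lift \<Omega> (\<lambda>v1 v2. S v1 \<odot>\<^bsub>\<Omega>\<^esub> \<psi> v2) (\<Delta> v)"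
  proof -
    have b: "bal \<Omega> (\<lambda>v1 v2. S v1 \<odot>\<^bsub>\<Omega>\<^esub> \<psi> v2)"
      by (rule HH_balancedI)
        (simp_all add: \<psi>_closed O.smult_l_distr O.smult_r_distr Der_sD(2-4)[OF \<psi>_Der] S_t O.smult_assoc1[symmetric] H.m_ac)
    moreover from b have "bal \<Omega> (\<lambda>u1 u2. tensor_lift \<Omega> (\<phi> u1) (\<Delta> u2))"
      unfolding balanced_def by (simp add: right)
    ultimately show ?thesis
      by (intro HH.tensor_lift_cong[OF ab]) (use v in \<open>simp_all add: right\<close>)
  qed
  finally show ?thesis .
qed

context
  fixes M :: "('h, 'm) module" and \<delta> :: "'h \<Rightarrow> 'm"
  assumes M: "module H M" and \<delta>: "\<delta> \<in> Der_s K A H s M"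
begin

interpretation M: module H M by (rule M)

lemmas Mab = M.abelian_group_axioms

text \<open>
  The map \<open>u \<mapsto> S(u\<^sub>1) \<delta>(u\<^sub>2)\<close> twists \<open>\<delta>\<close> back to the unit section: on a Lie group it is the
  left-invariant form \<open>g\<^sup>-\<^sup>1 dg\<close>.  It satisfies the Leibniz rule with coefficients
  \<open>t(\<epsilon> u)\<close>, so it kills \<open>I\<^sup>2\<close>; it kills \<open>s(A)\<close> because \<open>\<delta>\<close> does.  Hence its
  value at \<open>u\<close> depends on \<open>\<pi> u\<close> only.
\<close>

definition invariant_form :: "'h \<Rightarrow> 'm" where
  "invariant_form u = tensor_lift M (\<lambda>u v. S u \<odot>\<^bsub>M\<^esub> \<delta> v) (\<Delta> u)"

lemma \<delta>_s_mult: "a \<in> carrier A \<Longrightarrow> u \<in> carrier H \<Longrightarrow> \<delta> (s a \<otimes>\<^bsub>H\<^esub> u) = s a \<odot>\<^bsub>M\<^esub> \<delta> u"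
  by (simp add: Der_sD[OF \<delta>])

lemma \<delta>_mult_s: "a \<in> carrier A \<Longrightarrow> u \<in> carrier H \<Longrightarrow> \<delta> (u \<otimes>\<^bsub>H\<^esub> s a) = s a \<odot>\<^bsub>M\<^esub> \<delta> u"
  by (simp add: H.m_comm[of u] \<delta>_s_mult)

lemma invariant_form_balanced: "bal M (\<lambda>u v. S u \<odot>\<^bsub>M\<^esub> \<delta> v)"
  by (rule HH_balancedI)
    (simp_all add: Der_sD(1,2)[OF \<delta>] \<delta>_s_mult \<delta>_mult_s M.smult_l_distr M.smult_r_distr S_t M.smult_assoc1[symmetric] H.m_comm)

lemma invariant_form_add_hom: "invariant_form \<in> add_hom H M"
  unfolding invariant_form_def[abs_def]
  by (rule add_hom_comp[OF \<Delta>_add_hom HH.tensor_lift_hom[OF Mab invariant_form_balanced]])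

lemmas invariant_form_closed = add_hom_closed[OF invariant_form_add_hom] and invariant_form_add = add_hom_add[OF invariant_form_add_hom]

lemma invariant_form_mult:
  assumes "u \<in> carrier H" "v \<in> carrier H"
  shows "invariant_form (u \<otimes>\<^bsub>H\<^esub> v) = t (\<epsilon> u) \<odot>\<^bsub>M\<^esub> invariant_form v \<oplus>\<^bsub>M\<^esub> t (\<epsilon> v) \<odot>\<^bsub>M\<^esub> invariant_form u"
proof -
  have "S (u \<otimes>\<^bsub>H\<^esub> u') \<odot>\<^bsub>M\<^esub> \<delta> (v \<otimes>\<^bsub>H\<^esub> v') =
      (S u \<otimes>\<^bsub>H\<^esub> v) \<odot>\<^bsub>M\<^esub> (S u' \<odot>\<^bsub>M\<^esub> \<delta> v') \<oplus>\<^bsub>M\<^esub> (S u' \<otimes>\<^bsub>H\<^esub> v') \<odot>\<^bsub>M\<^esub> (S u \<odot>\<^bsub>M\<^esub> \<delta> v)"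
    if "u \<in> carrier H" "v \<in> carrier H" "u' \<in> carrier H" "v' \<in> carrier H" for u v u' v'
    using that
    by (simp add: Der_sD(1,3)[OF \<delta>] M.smult_r_distr M.smult_assoc1[symmetric] H.m_ac M.a_comm)
  from leibniz_on_HH[OF M invariant_form_balanced antipode_left_balanced this, of "\<Delta> u" "\<Delta> v"]
  show ?thesis using assms by (simp add: invariant_form_def \<Delta>_mult antipode_left)
qed

lemma invariant_form_s: assumes a: "a \<in> carrier A" shows "invariant_form (s a) = \<zero>\<^bsub>M\<^esub>"
  using a Der_sD(4)[OF \<delta> A.one_closed] 
  by (simp add: invariant_form_def \<Delta>_s HH_lift_pure[OF Mab invariant_form_balanced])

lemma invariant_form_s_mult: "a \<in> carrier A \<Longrightarrow> u \<in> carrier H \<Longrightarrow> invariant_form (s a \<otimes>\<^bsub>H\<^esub> u) = t a \<odot>\<^bsub>M\<^esub> invariant_form u"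
  by (simp add: invariant_form_mult invariant_form_s invariant_form_closed)

lemma invariant_form_mult_s: "a \<in> carrier A \<Longrightarrow> u \<in> carrier H \<Longrightarrow> invariant_form (u \<otimes>\<^bsub>H\<^esub> s a) = t a \<odot>\<^bsub>M\<^esub> invariant_form u"
  by (simp add: H.m_comm[of u] invariant_form_s_mult)

lemma invariant_form_J: "u \<in> J \<Longrightarrow> invariant_form u = \<zero>\<^bsub>M\<^esub>"
proof (induction u rule: ideal_prod.induct)
  case (prod i j) then show ?case by (simp add: mem_I_iff invariant_form_mult invariant_form_closed)
next
  case (sum u v) then show ?case by (simp add: invariant_form_add J.Icarr)
qed

lemma invariant_form_minus: "u \<in> carrier H \<Longrightarrow> v \<in> carrier H \<Longrightarrow> invariant_form (u \<ominus>\<^bsub>H\<^esub> v) = invariant_form u \<ominus>\<^bsub>M\<^esub> invariant_form v"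
proof -
  assume u: "u \<in> carrier H" "v \<in> carrier H"
  have "invariant_form (u \<ominus>\<^bsub>H\<^esub> v) \<oplus>\<^bsub>M\<^esub> invariant_form v = invariant_form u"
    using u by (simp add: a_minus_def H.a_assoc H.l_neg flip: invariant_form_add)
  then show ?thesis using u invariant_form_closed[of u] invariant_form_closed[of v] invariant_form_closed[of "u \<ominus>\<^bsub>H\<^esub> v"]
    by (simp add: M.minus_eq M.add.inv_solve_right)
qed

lemma invariant_form_cong: "u \<in> carrier H \<Longrightarrow> v \<in> carrier H \<Longrightarrow> \<pi> u = \<pi> v \<Longrightarrow> invariant_form u = invariant_form v"
proof -
  assume u: "u \<in> carrier H" "v \<in> carrier H" "\<pi> u = \<pi> v"
  \<comment> \<open>Elements with the same image under \<open>\<pi>\<close> differ modulo \<open>I\<^sup>2\<close> by an element of \<open>s(A)\<close>,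
    and \<open>invariant_form\<close> kills both.\<close>
  have "invariant_form w = invariant_form (w \<ominus>\<^bsub>H\<^esub> s (\<epsilon> w))" if "w \<in> carrier H" for w
    using that by (simp add: invariant_form_minus invariant_form_s invariant_form_closed M.minus_eq)
  then show ?thesis
    using invariant_form_J[OF \<pi>_eq_imp_minus_mem_J[OF u]] u minus_eq_zero_iff[OF Mab, of "invariant_form u" "invariant_form v"]
    by (simp add: invariant_form_minus invariant_form_closed)
qed

text \<open>
  The map that \<open>invariant_form\<close> induces on \<open>I/I\<^sup>2\<close>; the preimage under \<open>\<pi>\<close> that is chosen
  here may be replaced by any other one.
\<close>

definition cotangent_form :: "'h set \<Rightarrow> 'm" where "cotangent_form n = invariant_form (inv_into (carrier H) \<pi> n)"

lemma cotangent_form_\<pi>: "u \<in> carrier H \<Longrightarrow> cotangent_form (\<pi> u) = invariant_form u"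
  unfolding cotangent_form_def by (intro invariant_form_cong inv_into_into imageI f_inv_into_f)

lemma induced_map_balanced: "balanced A (along t H) I_mod_J M (\<lambda>u n. u \<odot>\<^bsub>M\<^esub> cotangent_form n)"
  by (rule balancedI)
    (auto simp: carrier_cotangent cotangent_form_\<pi> invariant_form_closed invariant_form_add M.smult_l_distr M.smult_r_distr invariant_form_s_mult invariant_form_mult_s
      M.smult_assoc1[symmetric] H.m_comm simp flip: \<pi>_add \<pi>_s_mult)

definition induced_map :: "_ \<Rightarrow> 'm" where "induced_map = tensor_lift M (\<lambda>u n. u \<odot>\<^bsub>M\<^esub> cotangent_form n)"

lemma induced_map_add_hom: "induced_map \<in> add_hom \<Omega> M"
  unfolding induced_map_def by (rule \<Omega>.tensor_lift_hom[OF Mab induced_map_balanced])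

lemma induced_map_pure: "u \<in> carrier H \<Longrightarrow> v \<in> carrier H \<Longrightarrow> induced_map (\<Omega>.pure u (\<pi> v)) = u \<odot>\<^bsub>M\<^esub> invariant_form v"
  unfolding induced_map_def by (simp add: \<Omega>.tensor_lift_pure[OF Mab induced_map_balanced] cotangent_form_\<pi>)

lemma induced_map_smult:
  assumes r: "r \<in> carrier H" and X: "X \<in> carrier \<Omega>"
  shows "induced_map (r \<odot>\<^bsub>\<Omega>\<^esub> X) = r \<odot>\<^bsub>M\<^esub> induced_map X"
proof -
  interpret O: module H \<Omega> by (rule \<Omega>_module)
  have 1: "(\<lambda>X. r \<odot>\<^bsub>\<Omega>\<^esub> X) \<in> add_hom \<Omega> \<Omega>" "(\<lambda>X. r \<odot>\<^bsub>M\<^esub> X) \<in> add_hom M M"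
    using r by (intro add_homI; simp add: O.smult_r_distr M.smult_r_distr)+
  show ?thesis
    by (rule \<Omega>.add_hom_eq_on_pure[OF Mab add_hom_comp[OF 1(1) induced_map_add_hom] add_hom_comp[OF induced_map_add_hom 1(2)] _ X])
      (use r in \<open>auto simp: carrier_cotangent \<Omega>_smult_pure induced_map_pure M.smult_assoc1 invariant_form_closed\<close>)
qed

text \<open>
  In Sweedler notation, \<open>u\<^sub>1 S(u\<^sub>2) \<delta>(u\<^sub>3) = s(\<epsilon> u\<^sub>1) \<delta>(u\<^sub>2) = \<delta>(s(\<epsilon> u\<^sub>1) u\<^sub>2) = \<delta> u\<close>,
  by the other antipode axiom and linearity of \<open>\<delta>\<close> along \<open>s\<close>.
\<close>

lemma induced_map_\<psi>:
  assumes u: "u \<in> carrier H" shows "induced_map (\<psi> u) = \<delta> u"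
proof -
  note Hab = H.abelian_group_axioms
  define \<phi> where "\<phi> = (\<lambda>a b c. (a \<otimes>\<^bsub>H\<^esub> S b) \<odot>\<^bsub>M\<^esub> \<delta> c)"
  have tri: "trilinear M \<phi>"
    unfolding trilinear_def \<phi>_def
    by (intro conjI ballI HH_balancedI)
      (simp_all add: Der_sD(1,2)[OF \<delta>] \<delta>_s_mult \<delta>_mult_s M.smult_l_distr M.smult_r_distr H.l_distr H.r_distr
        S_t S_s M.smult_assoc1[symmetric] H.m_ac)
  have right: "tensor_lift M (\<phi> a) (\<Delta> w) = induced_map (\<Omega>.pure a (\<pi> w))" if a: "a \<in> carrier H" and w: "w \<in> carrier H" for a w
  proof -
    have h: "(\<lambda>x. a \<odot>\<^bsub>M\<^esub> x) \<in> add_hom M M"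
      using a by (intro add_homI) (simp_all add: M.smult_r_distr)
    have "a \<odot>\<^bsub>M\<^esub> invariant_form w = tensor_lift M (\<lambda>x y. a \<odot>\<^bsub>M\<^esub> (S x \<odot>\<^bsub>M\<^esub> \<delta> y)) (\<Delta> w)"
      unfolding invariant_form_def by (rule HH.add_hom_tensor_lift[OF Mab Mab invariant_form_balanced h \<Delta>_closed[OF w]])
    also have "\<dots> = tensor_lift M (\<phi> a) (\<Delta> w)"
      using tri a w
      by (intro HH.tensor_lift_cong[OF Mab balanced_add_hom[OF invariant_form_balanced h]])
        (auto simp: trilinear_def \<phi>_def M.smult_assoc1 Der_sD(1)[OF \<delta>])
    finally show ?thesis using a w by (simp add: induced_map_pure)
  qed
  have left: "tensor_lift M (\<lambda>a b. \<phi> a b w) (\<Delta> v) = \<delta> (s (\<epsilon> v) \<otimes>\<^bsub>H\<^esub> w)"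
    if v: "v \<in> carrier H" and w: "w \<in> carrier H" for v w
  proof -
    have h: "(\<lambda>x. x \<odot>\<^bsub>M\<^esub> \<delta> w) \<in> add_hom H M"
      using w by (intro add_homI) (simp_all add: Der_sD(1)[OF \<delta>] M.smult_l_distr)
    show ?thesis
      using HH.add_hom_tensor_lift[OF Hab Mab antipode_right_balanced h \<Delta>_closed[OF v]] v w
      by (simp add: \<phi>_def antipode_right \<delta>_s_mult)
  qed
  have \<delta>_hom: "\<delta> \<in> add_hom H M" by (rule add_homI) (simp_all add: Der_sD(1,2)[OF \<delta>])
  note bl = balanced_add_hom[OF counit_left_balanced \<delta>_hom]
  note br = balanced_add_hom[OF \<psi>_balanced induced_map_add_hom]
  have "induced_map (\<psi> u) = tensor_lift M (\<lambda>a b. induced_map (\<Omega>.pure a (\<pi> b))) (\<Delta> u)"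
    using HH.add_hom_tensor_lift[OF \<Omega>.T_abelian Mab \<psi>_balanced induced_map_add_hom \<Delta>_closed[OF u]] u
    by (simp add: \<psi>_apply)
  also have "\<dots> = tensor_lift M (\<lambda>u1 u2. tensor_lift M (\<phi> u1) (\<Delta> u2)) (\<Delta> u)"
  proof (rule HH.tensor_lift_cong[OF Mab br])
    show "bal M (\<lambda>u1 u2. tensor_lift M (\<phi> u1) (\<Delta> u2))"
      using br unfolding balanced_def by (simp add: right)
  qed (use u in \<open>simp_all add: right\<close>)
  also have "\<dots> = tensor_lift M (\<lambda>u1 u2. tensor_lift M (\<lambda>a b. \<phi> a b u2) (\<Delta> u1)) (\<Delta> u)"
    by (rule coassociative_trilinear[OF Mab tri u, symmetric])
  also have "\<dots> = tensor_lift M (\<lambda>a b. \<delta> (s (\<epsilon> a) \<otimes>\<^bsub>H\<^esub> b)) (\<Delta> u)"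
  proof (rule HH.tensor_lift_cong[OF Mab _ bl])
    show "bal M (\<lambda>u1 u2. tensor_lift M (\<lambda>a b. \<phi> a b u2) (\<Delta> u1))"
      using bl unfolding balanced_def by (simp add: left)
  qed (use u in \<open>simp_all add: left\<close>)
  also have "\<dots> = \<delta> u"
    using HH.add_hom_tensor_lift[OF Hab Mab counit_left_balanced \<delta>_hom \<Delta>_closed[OF u]] u
    by (simp add: counit_left)
  finally show ?thesis .
qed

lemma exists_factorization: "\<exists>h\<in>module_hom H \<Omega> M. \<forall>u\<in>carrier H. h (\<psi> u) = \<delta> u"
proof
  interpret O: module H \<Omega> by (rule \<Omega>_module)
  show "restrict induced_map (carrier \<Omega>) \<in> module_hom H \<Omega> M"
    by (rule module_hom_restrictI[OF \<Omega>.T_abelian induced_map_add_hom]) (simp_all add: induced_map_smult)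
  show "\<forall>u\<in>carrier H. restrict induced_map (carrier \<Omega>) (\<psi> u) = \<delta> u"
    by (simp add: \<psi>_closed induced_map_\<psi>)
qed

end

lemma \<Omega>_hom_eqI:
  assumes M: "module H M" and f: "f \<in> module_hom H \<Omega> M" and g: "g \<in> module_hom H \<Omega> M"
    and eq: "\<And>u. u \<in> carrier H \<Longrightarrow> f (\<psi> u) = g (\<psi> u)" and X: "X \<in> carrier \<Omega>"
  shows "f X = g X"
proof -
  interpret M: module H M by fact
  interpret O: module H \<Omega> by (rule \<Omega>_module)
  note ab = \<Omega>.T_abelian and Mab = M.abelian_group_axioms
  have b: "bal \<Omega> (\<lambda>v1 v2. S v1 \<odot>\<^bsub>\<Omega>\<^esub> \<psi> v2)" by (rule invariant_form_balanced[OF \<Omega>_module \<psi>_Der])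
  have h: "h (\<Omega>.pure \<one>\<^bsub>H\<^esub> (\<pi> v)) = tensor_lift M (\<lambda>v1 v2. h (S v1 \<odot>\<^bsub>\<Omega>\<^esub> \<psi> v2)) (\<Delta> v)"
    if "h \<in> module_hom H \<Omega> M" "v \<in> carrier H" for h v
    using HH.add_hom_tensor_lift[OF ab Mab b module_hom_add_hom[OF that(1)] \<Delta>_closed[OF that(2)]] that
    by (simp add: pure_eq_antipode_\<psi>)
  have one: "f (\<Omega>.pure \<one>\<^bsub>H\<^esub> (\<pi> v)) = g (\<Omega>.pure \<one>\<^bsub>H\<^esub> (\<pi> v))" if v: "v \<in> carrier H" for v
    unfolding h[OF f v] h[OF g v]
    by (rule HH.tensor_lift_cong[OF Mab balanced_add_hom[OF b module_hom_add_hom[OF f]]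
          balanced_add_hom[OF b module_hom_add_hom[OF g]]])
      (use v in \<open>simp_all add: module_homD(3)[OF f] module_homD(3)[OF g] \<psi>_closed eq\<close>)
  have pure: "\<Omega>.pure u (\<pi> v) = u \<odot>\<^bsub>\<Omega>\<^esub> \<Omega>.pure \<one>\<^bsub>H\<^esub> (\<pi> v)" if "u \<in> carrier H" "v \<in> carrier H" for u v
    using that by (simp add: \<Omega>_smult_pure)
  show ?thesis
  proof (rule \<Omega>.add_hom_eq_on_pure[OF Mab module_hom_add_hom[OF f] module_hom_add_hom[OF g] _ X])
    fix x y assume "x \<in> carrier (along t H)" "y \<in> carrier I_mod_J"
    then obtain v where v: "v \<in> carrier H" "y = \<pi> v" and x: "x \<in> carrier H"
      by (auto simp: carrier_cotangent)
    show "f (\<Omega>.pure x y) = g (\<Omega>.pure x y)"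
      unfolding v(2) pure[OF x v(1)]
      using x v(1) by (simp add: module_homD(3)[OF f] module_homD(3)[OF g] \<Omega>_d(1) one)
  qed
qed

theorem \<psi>_universal: "module H M \<Longrightarrow> represents_Der_s K A H s \<Omega> \<psi> M"
proof (rule represents_Der_sI[OF _ \<Omega>_module \<psi>_Der], assumption)
  assume M: "module H M"
  fix f g X assume "f \<in> module_hom H \<Omega> M" "g \<in> module_hom H \<Omega> M"
    "\<And>u. u \<in> carrier H \<Longrightarrow> f (\<psi> u) = g (\<psi> u)" "X \<in> carrier \<Omega>"
  then show "f X = g X" by (rule \<Omega>_hom_eqI[OF M])
qed (rule exists_factorization)

end

section \<open>The Kaehler module\<close>

context commutative_hopf_algebroid
begin

text \<open>
  The rules for a symbol \<open>F (h, u)\<close> that behaves like \<open>h du\<close>; they say that \<open>F\<close> respects the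
  relations of the Kaehler module.
\<close>

definition kaehler_symbol :: "('p, 'r) ring_scheme \<Rightarrow> ('h \<times> 'h \<Rightarrow> 'p) \<Rightarrow> bool" where
  "kaehler_symbol P F \<longleftrightarrow>
    (\<forall>h\<in>carrier H. \<forall>h'\<in>carrier H. \<forall>u\<in>carrier H. F (h \<oplus>\<^bsub>H\<^esub> h', u) = F (h, u) \<oplus>\<^bsub>P\<^esub> F (h', u)) \<and>
    (\<forall>h\<in>carrier H. \<forall>u\<in>carrier H. \<forall>v\<in>carrier H. F (h, u \<oplus>\<^bsub>H\<^esub> v) = F (h, u) \<oplus>\<^bsub>P\<^esub> F (h, v)) \<and>
    (\<forall>h\<in>carrier H. \<forall>u\<in>carrier H. \<forall>v\<in>carrier H.
      F (h, u \<otimes>\<^bsub>H\<^esub> v) = F (h \<otimes>\<^bsub>H\<^esub> u, v) \<oplus>\<^bsub>P\<^esub> F (h \<otimes>\<^bsub>H\<^esub> v, u)) \<and>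
    (\<forall>h\<in>carrier H. \<forall>a\<in>carrier A. F (h, s a) = \<zero>\<^bsub>P\<^esub>)"

abbreviation "HxH \<equiv> carrier H \<times> carrier H"

lemma kaehler_rels_carrier: "kaehler_rels A H s \<subseteq> carrier (free_Abelian_group HxH)"
proof
  fix r assume "r \<in> kaehler_rels A H s"
  then have "Poly_Mapping.keys r \<subseteq> HxH"
    unfolding kaehler_rels_def
    by (elim UnE CollectE exE conjE; simp only:)
      ((rule keys_diff2_frag_of; simp), (rule keys_diff2_frag_of; simp), (rule keys_diff2_frag_of; simp), simp)
  then show "r \<in> carrier (free_Abelian_group HxH)" by simp
qed

lemma kaehler_rels_zero_iff:
  assumes P: "abelian_group P" and F: "F \<in> HxH \<rightarrow> carrier P"
  shows "(\<forall>r\<in>kaehler_rels A H s. free_eval P F r = \<zero>\<^bsub>P\<^esub>) \<longleftrightarrow> kaehler_symbol P F"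
proof
  assume *: "\<forall>r\<in>kaehler_rels A H s. free_eval P F r = \<zero>\<^bsub>P\<^esub>"
  note z = free_eval_diff2_eq_zero_iff[OF P F]
  show "kaehler_symbol P F"
    unfolding kaehler_symbol_def
  proof (intro conjI ballI)
    fix h h' u assume c: "h \<in> carrier H" "h' \<in> carrier H" "u \<in> carrier H"
    then have "frag_of (h \<oplus>\<^bsub>H\<^esub> h', u) - frag_of (h, u) - frag_of (h', u) \<in> kaehler_rels A H s"
      unfolding kaehler_rels_def by blast
    then show "F (h \<oplus>\<^bsub>H\<^esub> h', u) = F (h, u) \<oplus>\<^bsub>P\<^esub> F (h', u)"
      using * c by (intro z[THEN iffD1]) auto
  next
    fix h u v assume c: "h \<in> carrier H" "u \<in> carrier H" "v \<in> carrier H"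
    then have "frag_of (h, u \<oplus>\<^bsub>H\<^esub> v) - frag_of (h, u) - frag_of (h, v) \<in> kaehler_rels A H s"
      unfolding kaehler_rels_def by blast
    then show "F (h, u \<oplus>\<^bsub>H\<^esub> v) = F (h, u) \<oplus>\<^bsub>P\<^esub> F (h, v)"
      using * c by (intro z[THEN iffD1]) auto
    have "frag_of (h, u \<otimes>\<^bsub>H\<^esub> v) - frag_of (h \<otimes>\<^bsub>H\<^esub> u, v) - frag_of (h \<otimes>\<^bsub>H\<^esub> v, u) \<in> kaehler_rels A H s"
      unfolding kaehler_rels_def using c by blast
    then show "F (h, u \<otimes>\<^bsub>H\<^esub> v) = F (h \<otimes>\<^bsub>H\<^esub> u, v) \<oplus>\<^bsub>P\<^esub> F (h \<otimes>\<^bsub>H\<^esub> v, u)"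
      using * c by (intro z[THEN iffD1]) auto
  next
    fix h a assume c: "h \<in> carrier H" "a \<in> carrier A"
    then have "frag_of (h, s a) \<in> kaehler_rels A H s"
      unfolding kaehler_rels_def by blast
    moreover have "F (h, s a) \<in> carrier P" using F c by auto
    ultimately show "F (h, s a) = \<zero>\<^bsub>P\<^esub>" using * free_eval_frag_of[OF P, of F] by metis
  qed
next
  assume k: "kaehler_symbol P F"
  note z = free_eval_diff2_eq_zero_iff[OF P F, THEN iffD2]
  show "\<forall>r\<in>kaehler_rels A H s. free_eval P F r = \<zero>\<^bsub>P\<^esub>"
  proof
    fix r assume "r \<in> kaehler_rels A H s"
    then show "free_eval P F r = \<zero>\<^bsub>P\<^esub>"
      unfolding kaehler_rels_def
    proof (elim UnE CollectE exE conjE; simp only:)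
      fix h a assume c: "h \<in> carrier H" "a \<in> carrier A"
      then have "F (h, s a) \<in> carrier P" using F by auto
      then show "free_eval P F (frag_of (h, s a)) = \<zero>\<^bsub>P\<^esub>"
        using k c by (simp add: free_eval_frag_of[OF P] kaehler_symbol_def)
    qed (rule z; use k in \<open>simp add: kaehler_symbol_def\<close>)+
  qed
qed

abbreviation "\<Omega>K \<equiv> kaehler_module A H s"
abbreviation "d \<equiv> kaehler_d A H s"

sublocale \<Omega>K: presents \<Omega>K HxH "kaehler_rels A H s"
  unfolding kaehler_module_def by (rule presents_presented_module[OF kaehler_rels_carrier])

lemma kaehler_symbol_class: "kaehler_symbol \<Omega>K \<Omega>K.cls"
  using kaehler_rels_zero_iff[OF \<Omega>K.T_abelian, of \<Omega>K.cls] \<Omega>K.rel_cls \<Omega>K.cls_closed by auto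

lemma
  shows kaehler_is_module: "module H \<Omega>K"
    and kaehler_smult_class: "\<And>r h u. r \<in> carrier H \<Longrightarrow> h \<in> carrier H \<Longrightarrow> u \<in> carrier H \<Longrightarrow>
      r \<odot>\<^bsub>\<Omega>K\<^esub> \<Omega>K.cls (h, u) = \<Omega>K.cls (r \<otimes>\<^bsub>H\<^esub> h, u)"
proof -
  let ?Q = "presented_group HxH (kaehler_rels A H s)" and ?act = "\<lambda>r (h, u). (r \<otimes>\<^bsub>H\<^esub> h, u)"
  interpret Q: presents ?Q HxH "kaehler_rels A H s"
    by (rule presents_presented_group[OF kaehler_rels_carrier])
  have k: "kaehler_symbol ?Q Q.cls"
    using kaehler_rels_zero_iff[OF Q.T_abelian, of Q.cls] Q.rel_cls Q.cls_closed by auto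
  have act_rels: "free_eval ?Q (\<lambda>x. Q.cls (?act r x)) q = \<zero>\<^bsub>?Q\<^esub>"
    if r: "r \<in> carrier H" and q: "q \<in> kaehler_rels A H s" for r q
  proof -
    have "kaehler_symbol ?Q (\<lambda>x. Q.cls (?act r x))"
      using k r by (simp add: kaehler_symbol_def H.r_distr flip: H.m_assoc)
    moreover have "(\<lambda>x. Q.cls (?act r x)) \<in> HxH \<rightarrow> carrier ?Q"
      using r Q.cls_closed by auto
    ultimately show ?thesis using kaehler_rels_zero_iff[OF Q.T_abelian] q by blast
  qed
  note pm = presented_module_is_module[OF H.is_cring kaehler_rels_carrier, of ?act]
    presented_module_smult_class[OF H.is_cring kaehler_rels_carrier, of ?act]
  have add: "Q.cls (?act (r \<oplus>\<^bsub>H\<^esub> r') x) = Q.cls (?act r x) \<oplus>\<^bsub>?Q\<^esub> Q.cls (?act r' x)"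
    if "r \<in> carrier H" "r' \<in> carrier H" "x \<in> HxH" for r r' x
    using k that by (auto simp: kaehler_symbol_def H.l_distr)
  show "module H \<Omega>K"
    unfolding kaehler_module_def by (rule pm(1)) (use act_rels add in \<open>auto simp: H.m_assoc\<close>)
  show "r \<odot>\<^bsub>\<Omega>K\<^esub> \<Omega>K.cls (h, u) = \<Omega>K.cls (r \<otimes>\<^bsub>H\<^esub> h, u)"
    if "r \<in> carrier H" "h \<in> carrier H" "u \<in> carrier H" for r h u
    unfolding kaehler_module_def by (subst pm(2)) (use act_rels add that in \<open>auto simp: H.m_assoc\<close>)
qed

lemma d_apply: "u \<in> carrier H \<Longrightarrow> d u = \<Omega>K.cls (\<one>\<^bsub>H\<^esub>, u)"
  by (simp add: kaehler_d_def)

lemma class_eq_smult_d: "h \<in> carrier H \<Longrightarrow> u \<in> carrier H \<Longrightarrow> \<Omega>K.cls (h, u) = h \<odot>\<^bsub>\<Omega>K\<^esub> d u"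
  by (simp add: d_apply kaehler_smult_class)

lemma d_closed: "u \<in> carrier H \<Longrightarrow> d u \<in> carrier \<Omega>K"
  by (simp add: d_apply \<Omega>K.cls_closed)

lemma d_Der: "d \<in> Der_s K A H s \<Omega>K"
proof (rule Der_sI[OF kaehler_is_module])
  fix u v assume "u \<in> carrier H" "v \<in> carrier H"
  then show "d (u \<otimes>\<^bsub>H\<^esub> v) = u \<odot>\<^bsub>\<Omega>K\<^esub> d v \<oplus>\<^bsub>\<Omega>K\<^esub> v \<odot>\<^bsub>\<Omega>K\<^esub> d u"
    using kaehler_symbol_class by (simp add: d_apply kaehler_smult_class kaehler_symbol_def)
next
  show "d \<in> extensional (carrier H)" by (simp add: kaehler_d_def)
next
  fix u assume "u \<in> carrier H"
  then show "d u \<in> carrier \<Omega>K" by (rule d_closed)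
qed (use kaehler_symbol_class in \<open>simp_all add: d_apply kaehler_symbol_def\<close>)

text \<open>
  A derivation \<open>\<delta>\<close> is extended by \<open>h du \<mapsto> h \<delta>(u)\<close>; this is forced because the classes of
  the generators are the elements \<open>h du\<close>.
\<close>

theorem kaehler_universal:
  assumes M: "module H M" shows "represents_Der_s K A H s \<Omega>K d M"
proof (rule represents_Der_sI[OF M kaehler_is_module d_Der])
  interpret M: module H M by fact
  note Mab = M.abelian_group_axioms
  fix f g x assume f: "f \<in> module_hom H \<Omega>K M" and g: "g \<in> module_hom H \<Omega>K M"
    and eq: "\<And>u. u \<in> carrier H \<Longrightarrow> f (d u) = g (d u)" and x: "x \<in> carrier \<Omega>K"
  show "f x = g x"
    by (rule \<Omega>K.add_hom_eq_on_classes[OF Mab module_hom_add_hom[OF f] module_hom_add_hom[OF g] _ x])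
      (auto simp: class_eq_smult_d module_homD(3)[OF f] module_homD(3)[OF g] d_closed eq)
next
  interpret M: module H M by fact
  interpret W: module H \<Omega>K by (rule kaehler_is_module)
  note Mab = M.abelian_group_axioms
  fix \<delta> assume \<delta>: "\<delta> \<in> Der_s K A H s M"
  define F where "F = (\<lambda>(h, u). h \<odot>\<^bsub>M\<^esub> \<delta> u)"
  have F: "F \<in> HxH \<rightarrow> carrier M" by (auto simp: F_def Der_sD(1)[OF \<delta>])
  have "kaehler_symbol M F"
    by (simp add: kaehler_symbol_def F_def Der_sD(1-4)[OF \<delta>] M.smult_l_distr M.smult_r_distr M.smult_assoc1)
  then have z: "free_eval M F r = \<zero>\<^bsub>M\<^esub>" if "r \<in> kaehler_rels A H s" for r
    using kaehler_rels_zero_iff[OF Mab F] that by blast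
  define f where "f = presented_lift M F"
  have f: "f \<in> add_hom \<Omega>K M" unfolding f_def by (rule \<Omega>K.lift_add_hom[OF Mab F z])
  have f_cls: "f (\<Omega>K.cls (h, u)) = h \<odot>\<^bsub>M\<^esub> \<delta> u" if "h \<in> carrier H" "u \<in> carrier H" for h u
    unfolding f_def using \<Omega>K.lift_cls[OF Mab F z, of "(h, u)"] that by (simp add: F_def)
  have f_smult: "f (r \<odot>\<^bsub>\<Omega>K\<^esub> X) = r \<odot>\<^bsub>M\<^esub> f X" if r: "r \<in> carrier H" and X: "X \<in> carrier \<Omega>K" for r X
  proof -
    have 1: "(\<lambda>X. r \<odot>\<^bsub>\<Omega>K\<^esub> X) \<in> add_hom \<Omega>K \<Omega>K" "(\<lambda>X. r \<odot>\<^bsub>M\<^esub> X) \<in> add_hom M M"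
      using r by (intro add_homI; simp add: W.smult_r_distr M.smult_r_distr)+
    show ?thesis
      by (rule \<Omega>K.add_hom_eq_on_classes[OF Mab add_hom_comp[OF 1(1) f] add_hom_comp[OF f 1(2)] _ X])
        (use r in \<open>auto simp: kaehler_smult_class f_cls M.smult_assoc1 Der_sD(1)[OF \<delta>]\<close>)
  qed
  show "\<exists>f\<in>module_hom H \<Omega>K M. \<forall>u\<in>carrier H. f (d u) = \<delta> u"
  proof
    show "restrict f (carrier \<Omega>K) \<in> module_hom H \<Omega>K M"
      by (rule module_hom_restrictI[OF \<Omega>K.T_abelian f]) (simp_all add: f_smult)
    show "\<forall>u\<in>carrier H. restrict f (carrier \<Omega>K) (d u) = \<delta> u"
      by (simp add: d_closed) (simp add: d_apply f_cls Der_sD(1)[OF \<delta>])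
  qed
qed

end

theorem corollary5p9:
  fixes K :: "'k ring" and A :: "('k, 'a) module" and H :: "('k, 'h) module"
    and s t :: "'a \<Rightarrow> 'h"
    and \<Delta> :: "'h \<Rightarrow> ('h \<times> 'h \<Rightarrow>\<^sub>0 int) set"
    and \<epsilon> :: "'h \<Rightarrow> 'a"
    and S :: "'h \<Rightarrow> 'h"
  assumes "commutative_hopf_algebroid K A H s t \<Delta> \<epsilon> S"
  shows "module H (H_tensor_cotangent A H s t \<epsilon>) \<and>
    \<psi>\<^sub>s A H s t \<Delta> \<epsilon> \<in> Der_s K A H s (H_tensor_cotangent A H s t \<epsilon>) \<and>
    (\<forall>M :: ('h, 'm) module. module H M \<longrightarrow>
      represents_Der_s K A H s (H_tensor_cotangent A H s t \<epsilon>) (\<psi>\<^sub>s A H s t \<Delta> \<epsilon>) M) \<and>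
    module H (kaehler_module A H s) \<and>
    kaehler_d A H s \<in> Der_s K A H s (kaehler_module A H s) \<and>
    (\<exists>!\<phi>. \<phi> \<in> module_iso H (kaehler_module A H s) (H_tensor_cotangent A H s t \<epsilon>) \<and>
      (\<forall>u\<in>carrier H. \<phi> (kaehler_d A H s u) = \<psi>\<^sub>s A H s t \<Delta> \<epsilon> u))"
proof -
  interpret commutative_hopf_algebroid K A H s t \<Delta> \<epsilon> S by fact
  show ?thesis
    using representing_unique_iso[OF kaehler_is_module \<Omega>_module d_Der \<psi>_Der
        kaehler_universal[OF kaehler_is_module] kaehler_universal[OF \<Omega>_module]
        \<psi>_universal[OF kaehler_is_module] \<psi>_universal[OF \<Omega>_module]]
    by (intro conjI allI impI \<Omega>_module \<psi>_Der \<psi>_universal kaehler_is_module d_Der)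
qed

end
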